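(* Assume A1 (the Hessian of $f$ is $L$-Lipschitz). Run the algorithm Zero-Order CNM (described in the context) with inputs $x_0\in Q$, $\tau_0>0$, $\epsilon>0$, $m\in\mathbb{N}\setminus\{0\}$. Let $x_{k,\ell}(t)$ be the $t$-th iterate of ZeroOrderCubicSteps in the call made at the $k$-th iteration of Zero-Order CNM in the $\ell$-th inner loop (so $x_{k,\ell}(0)=x_k$). Let $T(\epsilon)\le+\infty$ be the first iteration index such that $$\|\nabla f(x_{T(\epsilon),\ell}(t))+\psi'(x_{T(\epsilon),\ell}(t))\|\le\epsilon$$ for some $\ell\ge0$ and $t\in\{0,\dots,m\}$. Then $$T(\epsilon)\;\le\;\frac{384\cdot2^{5/2}\,(2/3)^{1/6}\,\max\{\tau_0,L\}^{1/2}\,(F(x_0)-F^\star)}{\sqrt m}\,\epsilon^{-3/2},$$ and, consequently, the total number $\mathrm{ZO}_{T(\epsilon)}$ of function evaluations of $f$ performed during the first $T(\epsilon)$ iterations satisfies $$\mathrm{ZO}_{T(\epsilon)}\;\le\;\mathcal{O}\Bigl(\frac{mn+n^2}{\sqrt m}\max\{\tau_0,L\}^{1/2}(F(x_0)-F^\star)\,\epsilon^{-3/2}+(mn+3n^2)\log_2\frac{\max\{\tau_0,L\}}{\tau_0}\Bigr),$$ with an absolute constant hidden in $\mathcal{O}(\cdot)$.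
   Context: Setting: $\|\cdot\|$ is the Euclidean norm for vectors and the spectral norm for matrices; $e_1,\dots,e_n$ is the standard basis of $\mathbb{R}^n$. $f:\mathbb{R}^n\to\mathbb{R}$ is twice continuously differentiable (possibly non-convex), $\psi:\mathbb{R}^n\to\mathbb{R}\cup\{+\infty\}$ is proper, closed and convex (possibly non-differentiable), $Q=\operatorname{dom}\psi$, $F=f+\psi$, and $F^\star=\inf_{x\in Q}F(x)>-\infty$. Assumption A1: $\|\nabla^2 f(y)-\nabla^2 f(x)\|\le L\|y-x\|$ for all $x,y\in\mathbb{R}^n$, where $L\ge 0$. Procedure ZeroOrderCubicSteps$(x,B,\sigma,m,\epsilon)$ ($x\in Q$, $B=B^\top\in\mathbb{R}^{n\times n}$, $\sigma>0$, $m\ge1$, $\epsilon>0$): Step 0: set $x_0:=x$, $t:=0$. Step 1: if $t=m$, stop and return $(x_t,\text{success})$. Step 2: with $h_g=\frac{1}{3^{1/3}}\bigl[\frac{\epsilon m}{\sigma n^{1/2}}\bigr]^{1/2}$ compute $g_t\in\mathbb{R}^n$ by $[g_t]^{(i)}=\frac{f(x_t+h_ge_i)-f(x_t-h_ge_i)}{2h_g}$, $i=1,\dots,n$. Step 3: with $M_{x_t,\sigma}(y)=f(x_t)+\langle g_t,y-x_t\rangle+\frac12\langle B(y-x_t),y-x_t\rangle+\frac{\sigma}{6}\|y-x_t\|^3$, compute $x_{t+1}\in Q$ as an approximate minimizer of $M_{x_t,\sigma}+\psi$ over $Q$ such that $M_{x_t,\sigma}(x_{t+1})+\psi(x_{t+1})\le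 F(x_t)$ and $\|\nabla M_{x_t,\sigma}(x_{t+1})+\psi'(x_{t+1})\|\le\frac{\sigma}{4}\|x_{t+1}-x_t\|^2$ for some $\psi'(x_{t+1})\in\partial\psi(x_{t+1})$. Step 4: if $F(x_0)-F(x_{t+1})\ge\frac{\epsilon^{3/2}}{384\,\sigma^{1/2}}(t+1)$, set $t:=t+1$ and go to Step 1; otherwise stop and return $(x_{t+1},\text{halt})$. For an iterate $x_{t}$ with $t\ge1$, $\psi'(x_{t})$ denotes the subgradient appearing in Step 3; for a starting point it is a subgradient of $\psi$ there. Algorithm Zero-Order CNM: Step 0: given $x_0\in Q$, $\tau_0>0$, $\epsilon>0$, $m\ge1$, set $k:=0$. Step 1: set $\ell:=0$. Step 1.1: with $\sigma_{k,\ell}=2^4(2/3)^{1/3}(2^\ell\tau_k)m$ and $h_{k,\ell}=\Bigl[\frac{3^4\sigma_{k,\ell}^{3/2}\epsilon^{3/2}}{2^{14}\cdot192\,n^3(2^\ell\tau_k)^3}\Bigr]^{1/3}$, compute $B_{k,\ell}=\frac12(A_{k,\ell}+A_{k,\ell}^\top)$ where, with $h=h_{k,\ell}$, $[A_{k,\ell}]^{(i,j)}=\frac{f(x_k+he_i+he_j)-f(x_k+he_i)-f(x_k+he_j)+f(x_k)}{h^2}$, $i,j=1,\dots,n$. Step 1.2: $(\hat x_{k,\ell},\alpha_{k,\ell})=$ ZeroOrderCubicSteps$(x_k,B_{k,\ell},\sigma_{k,\ell},m,\epsilon)$. Step 2: if $\alpha_{k,\ell}=\text{halt}$, set $\ell:=\ell+1$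 and go to Step 1.1. Step 3: let $\ell_k$ be the current $\ell$; set $x_{k+1}=\hat x_{k,\ell_k}$, $\tau_{k+1}=\max\{\tau_0,2^{\ell_k-1}\tau_k\}$, $k:=k+1$, and go to Step 1. *)

theory Defs
  imports "HOL-Analysis.Analysis" "HOL-Library.Multiset"
begin

section \<open>Smooth and convex parts of the objective\<close>

definition grad :: "('a::real_inner \<Rightarrow> real) \<Rightarrow> 'a \<Rightarrow> 'a" where
  "grad f x = (THE D. GDERIV f x :> D)"

definition hessian :: "(real^'n \<Rightarrow> real) \<Rightarrow> real^'n \<Rightarrow> real^'n^'n" where
  "hessian f x = jacobian (grad f) (at x)"

definition C2 :: "(real^'n \<Rightarrow> real) \<Rightarrow> bool" where
  "C2 f \<longleftrightarrow> (\<forall>x. f differentiable (at x)) \<and> (\<forall>x. grad f differentiable (at x))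
     \<and> continuous_on UNIV (hessian f)"

definition spectral_norm :: "real^'n^'n \<Rightarrow> real" where
  "spectral_norm A = onorm (\<lambda>v. A *v v)"

definition lipschitz_hessian :: "real \<Rightarrow> (real^'n \<Rightarrow> real) \<Rightarrow> bool" where
  "lipschitz_hessian L f \<longleftrightarrow>
     (\<forall>x y. spectral_norm (hessian f y - hessian f x) \<le> L * norm (y - x))"

definition edom :: "('a \<Rightarrow> ereal) \<Rightarrow> 'a set" where
  "edom \<psi> = {x. \<psi> x < \<infinity>}"

definition epi :: "('a \<Rightarrow> ereal) \<Rightarrow> ('a \<times> real) set" where
  "epi \<psi> = {(x, r). \<psi> x \<le> ereal r}"

definition proper_closed_convex :: "('a::real_normed_vector \<Rightarrow> ereal) \<Rightarrow> bool" where
  "proper_closed_convex \<psi> \<longleftrightarrow>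
     (\<forall>x. \<psi> x \<noteq> -\<infinity>) \<and> edom \<psi> \<noteq> {} \<and> closed (epi \<psi>) \<and> convex (epi \<psi>)"

definition subdiff :: "('a::real_inner \<Rightarrow> ereal) \<Rightarrow> 'a \<Rightarrow> 'a set" where
  "subdiff \<psi> x = {g. x \<in> edom \<psi> \<and> (\<forall>y. \<psi> x + ereal (g \<bullet> (y - x)) \<le> \<psi> y)}"

definition obj :: "('a \<Rightarrow> real) \<Rightarrow> ('a \<Rightarrow> ereal) \<Rightarrow> 'a \<Rightarrow> ereal" where
  "obj f \<psi> x = ereal (f x) + \<psi> x"

definition inf_obj :: "('a \<Rightarrow> real) \<Rightarrow> ('a \<Rightarrow> ereal) \<Rightarrow> ereal" where
  "inf_obj f \<psi> = (INF x\<in>edom \<psi>. obj f \<psi> x)"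


section \<open>The procedure ZeroOrderCubicSteps\<close>

definition fd_grad :: "(real^'n \<Rightarrow> real) \<Rightarrow> real \<Rightarrow> real^'n \<Rightarrow> real^'n" where
  "fd_grad f h x = (\<chi> i. (f (x + h *\<^sub>R axis i 1) - f (x - h *\<^sub>R axis i 1)) / (2 * h))"

definition grad_step :: "nat \<Rightarrow> real \<Rightarrow> nat \<Rightarrow> real \<Rightarrow> real" where
  "grad_step n \<sigma> m \<epsilon> =
     1 / (3 powr (1/3)) * (\<epsilon> * real m / (\<sigma> * real n powr (1/2))) powr (1/2)"

definition cubic_model ::
    "real \<Rightarrow> real^'n \<Rightarrow> real^'n^'n \<Rightarrow> real \<Rightarrow> real^'n \<Rightarrow> real^'n \<Rightarrow> real" where
  "cubic_model fx g B \<sigma> x y =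
     fx + g \<bullet> (y - x) + 1/2 * ((B *v (y - x)) \<bullet> (y - x)) + \<sigma>/6 * norm (y - x) ^ 3"

definition cubic_step ::
    "(real^'n \<Rightarrow> real) \<Rightarrow> (real^'n \<Rightarrow> ereal) \<Rightarrow> real^'n^'n \<Rightarrow> real \<Rightarrow> nat \<Rightarrow> real
      \<Rightarrow> real^'n \<Rightarrow> real^'n \<Rightarrow> real^'n \<Rightarrow> bool" where
  "cubic_step f \<psi> B \<sigma> m \<epsilon> x y s \<longleftrightarrow>
     (let g = fd_grad f (grad_step CARD('n) \<sigma> m \<epsilon>) x;
          M = cubic_model (f x) g B \<sigma> x
      in y \<in> edom \<psi> \<and> s \<in> subdiff \<psi> y
         \<and> ereal (M y) + \<psi> y \<le> obj f \<psi> x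
         \<and> norm (grad M y + s) \<le> \<sigma>/4 * (norm (y - x))\<^sup>2)"

definition decrease_test ::
    "('a \<Rightarrow> real) \<Rightarrow> ('a \<Rightarrow> ereal) \<Rightarrow> real \<Rightarrow> real \<Rightarrow> 'a \<Rightarrow> nat \<Rightarrow> 'a \<Rightarrow> bool" where
  "decrease_test f \<psi> \<sigma> \<epsilon> x0 t y \<longleftrightarrow>
     obj f \<psi> x0 - obj f \<psi> y \<ge> ereal (\<epsilon> powr (3/2) / (384 * \<sigma> powr (1/2)) * real (t + 1))"

datatype outcome = Success | Halt

text \<open>
  The record of one call. The iterates are \<open>iter 0, \<dots>, iter steps\<close>, the last of which is the
  returned point (also when the call halts); entries beyond \<open>steps\<close> are irrelevant.
  For \<open>1 \<le> t \<le> steps\<close>, \<open>subgr t\<close> is the subgradient used in computing \<open>iter t\<close>. The entry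
  \<open>subgr 0\<close> is the choice of a subgradient at the starting point; the procedure does not use it
  and the subdifferential may be empty there, so it is not constrained here, see \<open>eps_stationary\<close>.
\<close>

record 'v cubic_call =
  iter :: "nat \<Rightarrow> 'v"
  subgr :: "nat \<Rightarrow> 'v"
  steps :: nat
  outcome :: outcome

definition zero_order_cubic_steps ::
    "(real^'n \<Rightarrow> real) \<Rightarrow> (real^'n \<Rightarrow> ereal) \<Rightarrow> real^'n \<Rightarrow> real^'n^'n \<Rightarrow> real \<Rightarrow> nat \<Rightarrow> real
      \<Rightarrow> (real^'n) cubic_call \<Rightarrow> bool" where
  "zero_order_cubic_steps f \<psi> x B \<sigma> m \<epsilon> c \<longleftrightarrow>
     iter c 0 = x
     \<and> (\<forall>t < steps c. cubic_step f \<psi> B \<sigma> m \<epsilon> (iter c t) (iter c (t + 1)) (subgr c (t + 1)))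
     \<and> (case outcome c of
          Success \<Rightarrow> steps c = m
            \<and> (\<forall>t < m. decrease_test f \<psi> \<sigma> \<epsilon> x t (iter c (t + 1)))
        | Halt \<Rightarrow> 1 \<le> steps c \<and> steps c \<le> m
            \<and> (\<forall>t < steps c - 1. decrease_test f \<psi> \<sigma> \<epsilon> x t (iter c (t + 1)))
            \<and> \<not> decrease_test f \<psi> \<sigma> \<epsilon> x (steps c - 1) (iter c (steps c)))"


section \<open>The algorithm Zero-Order CNM\<close>

definition reg_param :: "real \<Rightarrow> nat \<Rightarrow> nat \<Rightarrow> real" where
  "reg_param \<tau> l m = 2 ^ 4 * (2/3) powr (1/3) * (2 ^ l * \<tau>) * real m"

definition hess_step :: "nat \<Rightarrow> real \<Rightarrow> nat \<Rightarrow> nat \<Rightarrow> real \<Rightarrow> real" where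
  "hess_step n \<tau> l m \<epsilon> =
     (3 ^ 4 * reg_param \<tau> l m powr (3/2) * \<epsilon> powr (3/2)
       / (2 ^ 14 * 192 * real n ^ 3 * (2 ^ l * \<tau>) ^ 3)) powr (1/3)"

definition fd_matrix :: "(real^'n \<Rightarrow> real) \<Rightarrow> real \<Rightarrow> real^'n \<Rightarrow> real^'n^'n" where
  "fd_matrix f h x = (\<chi> i j.
     (f (x + h *\<^sub>R axis i 1 + h *\<^sub>R axis j 1) - f (x + h *\<^sub>R axis i 1) - f (x + h *\<^sub>R axis j 1) + f x)
       / h\<^sup>2)"

definition fd_hess :: "(real^'n \<Rightarrow> real) \<Rightarrow> real \<Rightarrow> real^'n \<Rightarrow> real^'n^'n" where
  "fd_hess f h x = (1/2) *\<^sub>R (fd_matrix f h x + transpose (fd_matrix f h x))"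

text \<open>
  \<open>executed oc k l\<close>: inner loop \<open>l\<close> of iteration \<open>k\<close> is reached, where \<open>oc k l\<close> is the outcome of
  the call made there. An iteration whose calls all halt is never left, and no later one is reached.
\<close>

inductive executed :: "(nat \<Rightarrow> nat \<Rightarrow> outcome) \<Rightarrow> nat \<Rightarrow> nat \<Rightarrow> bool" for oc where
  start: "executed oc 0 0"
| retry: "executed oc k l \<Longrightarrow> oc k l = Halt \<Longrightarrow> executed oc k (l + 1)"
| advance: "executed oc k l \<Longrightarrow> oc k l = Success \<Longrightarrow> executed oc (k + 1) 0"

record 'v cnm_run =
  outer :: "nat \<Rightarrow> 'v"
  tau :: "nat \<Rightarrow> real"
  call :: "nat \<Rightarrow> nat \<Rightarrow> 'v cubic_call"

definition reached :: "'v cnm_run \<Rightarrow> nat \<Rightarrow> nat \<Rightarrow> bool" where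
  "reached r = executed (\<lambda>k l. outcome (call r k l))"

definition zero_order_cnm ::
    "(real^'n \<Rightarrow> real) \<Rightarrow> (real^'n \<Rightarrow> ereal) \<Rightarrow> real^'n \<Rightarrow> real \<Rightarrow> real \<Rightarrow> nat
      \<Rightarrow> (real^'n) cnm_run \<Rightarrow> bool" where
  "zero_order_cnm f \<psi> x0 \<tau>0 \<epsilon> m r \<longleftrightarrow>
     outer r 0 = x0 \<and> tau r 0 = \<tau>0
     \<and> (\<forall>k l. reached r k l \<longrightarrow>
          zero_order_cubic_steps f \<psi> (outer r k)
            (fd_hess f (hess_step CARD('n) (tau r k) l m \<epsilon>) (outer r k))
            (reg_param (tau r k) l m) m \<epsilon> (call r k l))
     \<and> (\<forall>k l. reached r k l \<and> outcome (call r k l) = Success \<longrightarrow>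
          outer r (k + 1) = iter (call r k l) (steps (call r k l))
          \<and> tau r (k + 1) = max \<tau>0 (2 powi (int l - 1) * tau r k))"


section \<open>Iteration and evaluation complexity\<close>

definition eps_stationary ::
    "(real^'n \<Rightarrow> real) \<Rightarrow> (real^'n \<Rightarrow> ereal) \<Rightarrow> real \<Rightarrow> (real^'n) cubic_call \<Rightarrow> nat \<Rightarrow> bool" where
  "eps_stationary f \<psi> \<epsilon> c t \<longleftrightarrow>
     subgr c t \<in> subdiff \<psi> (iter c t) \<and> norm (grad f (iter c t) + subgr c t) \<le> \<epsilon>"

text \<open>The infimum of the empty set is \<open>\<infinity>\<close>.\<close>

definition hitting_time ::
    "(real^'n \<Rightarrow> real) \<Rightarrow> (real^'n \<Rightarrow> ereal) \<Rightarrow> real \<Rightarrow> (real^'n) cnm_run \<Rightarrow> enat" where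
  "hitting_time f \<psi> \<epsilon> r =
     Inf {enat k | k. \<exists>l t. reached r k l \<and> t \<le> steps (call r k l)
                        \<and> eps_stationary f \<psi> \<epsilon> (call r k l) t}"

text \<open>
  Multisets of the points at which \<open>f\<close> is evaluated. Every occurrence of a value of \<open>f\<close> in the
  finite-difference formulas is counted, without reuse of values. In addition, each step counts
  \<open>f\<close> at the current point (for the cubic model) and at the two points in the decrease test.
\<close>

definition grad_queries :: "real \<Rightarrow> real^'n \<Rightarrow> (real^'n) multiset" where
  "grad_queries h x = (\<Sum>i\<in>UNIV. {# x + h *\<^sub>R axis i 1, x - h *\<^sub>R axis i 1 #})"

definition hess_queries :: "real \<Rightarrow> real^'n \<Rightarrow> (real^'n) multiset" where
  "hess_queries h x = (\<Sum>i\<in>UNIV. \<Sum>j\<in>UNIV.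
     {# x + h *\<^sub>R axis i 1 + h *\<^sub>R axis j 1, x + h *\<^sub>R axis i 1, x + h *\<^sub>R axis j 1, x #})"

definition call_queries ::
    "real \<Rightarrow> nat \<Rightarrow> (real^'n) cnm_run \<Rightarrow> nat \<Rightarrow> nat \<Rightarrow> (real^'n) multiset" where
  "call_queries \<epsilon> m r k l =
     (let c = call r k l
      in hess_queries (hess_step CARD('n) (tau r k) l m \<epsilon>) (outer r k)
         + (\<Sum>t < steps c.
              grad_queries (grad_step CARD('n) (reg_param (tau r k) l m) m \<epsilon>) (iter c t)
              + {# iter c t, iter c 0, iter c (t + 1) #}))"

text \<open>
  The number of evaluations during the first \<open>T\<close> iterations \<open>k = 0, \<dots>, T - 1\<close>. The sum is taken
  in \<open>ereal\<close>, as an iteration in which every call halts makes infinitely many calls.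
\<close>

definition zo_count :: "real \<Rightarrow> nat \<Rightarrow> (real^'n) cnm_run \<Rightarrow> enat \<Rightarrow> ereal" where
  "zo_count \<epsilon> m r T =
     (\<Sum>\<^sub>\<infinity>(k, l) \<in> {(k, l). reached r k l \<and> enat k < T}.
        ereal (real (size (call_queries \<epsilon> m r k l))))"

text \<open>
  The absolute constant of the evaluation bound. It is a numeral because a constant that is
  existentially quantified in a statement over \<open>real^'n\<close> could depend on the dimension.
\<close>

definition zo_const :: real where
  "zo_const = 30000"

end

theory Submission
  imports Defs
begin

text \<open>
  With \<open>\<sigma>\<close> proportional to \<open>m\<close> times an upper bound of the Lipschitz constant \<open>L\<close>, and steps measured
  in units of \<open>E = sqrt (\<epsilon> / \<sigma>)\<close>, both finite-difference errors are small. If the new point is not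
  \<open>\<epsilon>\<close>-stationary, one cubic step of length \<open>r\<close> taken at distance \<open>d\<close> from the point where the Hessian
  was computed decreases the objective by at least
  \<open>\<sigma> E^3 / 384 + \<sigma> (r^3 / 20 - (1728/20) (L d / \<sigma>)^3)\<close>: either \<open>r\<close> is at least \<open>E\<close>, or the gradient
  bound forces \<open>L d\<close> to be large. By the power mean inequality the cubes of the distances in a block
  of at most \<open>m\<close> steps sum up to at most \<open>m^3\<close> times the sum of the cubed step lengths, so that the
  terms in brackets have a nonnegative sum. Hence no call halts once \<open>2^l \<tau>\<close> is at least \<open>L\<close>, every
  iteration without a stationary point decreases the objective by a fixed amount, and the numbers of
  retries telescope through the logarithms of \<open>\<tau>\<close>.
\<close>

section \<open>Taylor estimates\<close>

text \<open>\<open>grad\<close> is a definite description, so existence and uniqueness of a gradient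
  must come first. Existence is Riesz representation in the standard basis; uniqueness follows from
  that of the derivative.\<close>

lemma has_derivative_grad:
  fixes f :: "real^'n \<Rightarrow> real"
  assumes "f differentiable (at x)"
  shows "(f has_derivative (\<lambda>v. v \<bullet> grad f x)) (at x)"
proof -
  obtain D where D: "(f has_derivative D) (at x)"
    using assms unfolding differentiable_def by blast
  have lin: "linear D" using D has_derivative_linear by blast
  define g where "g = (\<Sum>b\<in>Basis. D b *\<^sub>R b)"
  have eq: "D = (\<lambda>v. v \<bullet> g)"
  proof
    fix v
    have "D v = D (\<Sum>b\<in>Basis. (v \<bullet> b) *\<^sub>R b)" by (simp add: euclidean_representation)
    also have "\<dots> = (\<Sum>b\<in>Basis. (v \<bullet> b) * D b)"
      using lin by (simp add: linear_sum linear_scale)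
    also have "\<dots> = v \<bullet> g" by (simp add: g_def inner_sum_right mult.commute)
    finally show "D v = v \<bullet> g" .
  qed
  have G: "GDERIV f x :> g" using D eq by (simp add: gderiv_def)
  have "g' = g" if "GDERIV f x :> g'" for g'
  proof -
    have "(\<lambda>v. v \<bullet> g') = (\<lambda>v. v \<bullet> g)"
      using that G unfolding gderiv_def by (rule has_derivative_unique)
    then have "\<And>v. v \<bullet> g' = v \<bullet> g" by metis
    then show ?thesis by (metis vector_eq_ldot)
  qed
  with G have "grad f x = g" unfolding grad_def by (rule the_equality)
  with D eq show ?thesis by simp
qed

lemma grad_eqI:
  fixes f :: "real^'n \<Rightarrow> real"
  assumes "(f has_derivative (\<lambda>v. v \<bullet> g)) (at x)"
  shows "grad f x = g"
proof -
  have "f differentiable (at x)" using assms differentiableI by blast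
  from has_derivative_unique[OF has_derivative_grad[OF this] assms]
  have "\<And>v. v \<bullet> grad f x = v \<bullet> g" by metis
  then show ?thesis by (metis vector_eq_ldot)
qed

lemma C2_has_derivative:
  fixes f :: "real^'n \<Rightarrow> real"
  assumes "C2 f"
  shows "(f has_derivative (\<lambda>v. v \<bullet> grad f x)) (at x)"
  using assms has_derivative_grad unfolding C2_def by blast

lemma C2_grad_has_derivative:
  fixes f :: "real^'n \<Rightarrow> real"
  assumes "C2 f"
  shows "(grad f has_derivative (\<lambda>v. hessian f x *v v)) (at x)"
  using assms unfolding C2_def hessian_def by (simp add: jacobian_works[symmetric])

lemma has_vector_derivative_along_line:
  assumes "\<And>y. (f has_derivative f' y) (at y)"
  shows "((\<lambda>t. f (x + t *\<^sub>R v)) has_vector_derivative f' (x + t *\<^sub>R v) v) (at t)"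
proof -
  have "((\<lambda>t. x + t *\<^sub>R v) has_derivative (\<lambda>t. t *\<^sub>R v)) (at t)"
    by (auto intro!: derivative_eq_intros)
  then have "((\<lambda>t. f (x + t *\<^sub>R v)) has_derivative (\<lambda>s. f' (x + t *\<^sub>R v) (s *\<^sub>R v))) (at t)"
    by (rule has_derivative_compose[OF _ assms])
  moreover have "f' (x + t *\<^sub>R v) (s *\<^sub>R v) = s *\<^sub>R f' (x + t *\<^sub>R v) v" for s
    using has_derivative_linear[OF assms] by (rule linear_scale)
  ultimately show ?thesis unfolding has_vector_derivative_def by simp
qed

text \<open>Mean value inequality with a comparison function. Each remainder below is estimated by
  exhibiting a real function whose derivative dominates, in place of an integral remainder.\<close>

lemma vector_derivative_bound:
  fixes f :: "real \<Rightarrow> 'a::real_normed_vector"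
  assumes "a < b"
    and f: "\<And>t. (f has_vector_derivative f' t) (at t)"
    and g: "\<And>t. (g has_vector_derivative g' t) (at t)"
    and "\<And>t. a < t \<Longrightarrow> t < b \<Longrightarrow> norm (f' t) \<le> g' t"
  shows "norm (f b - f a) \<le> g b - g a"
proof (rule differentiable_bound_general[OF \<open>a < b\<close>])
  show "continuous_on {a..b} f" "continuous_on {a..b} g"
    using has_vector_derivative_continuous[OF f] has_vector_derivative_continuous[OF g]
    by (auto intro!: continuous_at_imp_continuous_on)
qed (use assms in auto)

lemma norm_matrix_vector_le: "norm (A *v v) \<le> spectral_norm A * norm v"
  unfolding spectral_norm_def by (rule onorm) (rule matrix_vector_mul_bounded_linear)

lemma lipschitz_hessian_mult:
  assumes "lipschitz_hessian L f"
  shows "norm (hessian f y *v v - hessian f x *v v) \<le> L * norm (y - x) * norm v"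
proof -
  have "norm ((hessian f y - hessian f x) *v v) \<le> spectral_norm (hessian f y - hessian f x) * norm v"
    by (rule norm_matrix_vector_le)
  also have "\<dots> \<le> L * norm (y - x) * norm v"
    using assms unfolding lipschitz_hessian_def by (intro mult_right_mono) auto
  finally show ?thesis by (simp add: matrix_vector_mult_diff_rdistrib)
qed

lemma grad_taylor:
  fixes f :: "real^'n \<Rightarrow> real"
  assumes f: "C2 f" and L: "lipschitz_hessian L f"
  shows "norm (grad f (x + v) - grad f x - hessian f x *v v) \<le> L / 2 * (norm v)\<^sup>2"
proof -
  have "norm ((grad f (x + 1 *\<^sub>R v) - 1 *\<^sub>R (hessian f x *v v))
      - (grad f (x + 0 *\<^sub>R v) - 0 *\<^sub>R (hessian f x *v v)))
      \<le> L / 2 * (norm v)\<^sup>2 * 1\<^sup>2 - L / 2 * (norm v)\<^sup>2 * 0\<^sup>2"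
  proof (rule vector_derivative_bound[where f="\<lambda>t. grad f (x + t *\<^sub>R v) - t *\<^sub>R (hessian f x *v v)"
        and g="\<lambda>t. L / 2 * (norm v)\<^sup>2 * t\<^sup>2"
        and f'="\<lambda>t. hessian f (x + t *\<^sub>R v) *v v - hessian f x *v v"
        and g'="\<lambda>t. L * (norm v)\<^sup>2 * t"])
    fix t
    show "((\<lambda>t. grad f (x + t *\<^sub>R v) - t *\<^sub>R (hessian f x *v v)) has_vector_derivative
        hessian f (x + t *\<^sub>R v) *v v - hessian f x *v v) (at t)"
      by (auto intro!: derivative_eq_intros
          has_vector_derivative_along_line[OF C2_grad_has_derivative[OF f]])
    show "((\<lambda>t. L / 2 * (norm v)\<^sup>2 * t\<^sup>2) has_vector_derivative L * (norm v)\<^sup>2 * t) (at t)"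
      unfolding has_real_derivative_iff_has_vector_derivative[symmetric]
      by (auto intro!: derivative_eq_intros)
  next
    fix t :: real assume "0 < t"
    then show "norm (hessian f (x + t *\<^sub>R v) *v v - hessian f x *v v) \<le> L * (norm v)\<^sup>2 * t"
      using lipschitz_hessian_mult[OF L, of "x + t *\<^sub>R v" v x]
      by (simp add: power2_eq_square mult_ac)
  qed simp
  then show ?thesis by (simp add: algebra_simps)
qed

text \<open>Differentiating the scalar remainder in \<open>t\<close> gives \<open>v\<close> paired
  with the gradient remainder for the displacement \<open>t *\<^sub>R v\<close>, so
  \<open>grad_taylor\<close> is integrated once more.\<close>

lemma taylor2:
  fixes f :: "real^'n \<Rightarrow> real"
  assumes f: "C2 f" and L: "lipschitz_hessian L f"
  shows "\<bar>f (x + v) - f x - v \<bullet> grad f x - v \<bullet> (hessian f x *v v) / 2\<bar> \<le> L / 6 * norm v ^ 3"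
proof -
  let ?H = "hessian f x *v v"
  have "norm ((f (x + 1 *\<^sub>R v) - 1 * (v \<bullet> grad f x) - 1\<^sup>2 * (v \<bullet> ?H / 2))
      - (f (x + 0 *\<^sub>R v) - 0 * (v \<bullet> grad f x) - 0\<^sup>2 * (v \<bullet> ?H / 2)))
      \<le> L / 6 * norm v ^ 3 * 1 ^ 3 - L / 6 * norm v ^ 3 * 0 ^ 3"
  proof (rule vector_derivative_bound[where
        f="\<lambda>t. f (x + t *\<^sub>R v) - t * (v \<bullet> grad f x) - t\<^sup>2 * (v \<bullet> ?H / 2)"
        and g="\<lambda>t. L / 6 * norm v ^ 3 * t ^ 3"
        and f'="\<lambda>t. v \<bullet> grad f (x + t *\<^sub>R v) - v \<bullet> grad f x - t * (v \<bullet> ?H)"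
        and g'="\<lambda>t. L / 2 * norm v ^ 3 * t\<^sup>2"])
    fix t
    have "((\<lambda>t. f (x + t *\<^sub>R v)) has_real_derivative v \<bullet> grad f (x + t *\<^sub>R v)) (at t)"
      using has_vector_derivative_along_line[OF C2_has_derivative[OF f]]
      unfolding has_real_derivative_iff_has_vector_derivative by blast
    then show "((\<lambda>t. f (x + t *\<^sub>R v) - t * (v \<bullet> grad f x) - t\<^sup>2 * (v \<bullet> ?H / 2)) has_vector_derivative
        v \<bullet> grad f (x + t *\<^sub>R v) - v \<bullet> grad f x - t * (v \<bullet> ?H)) (at t)"
      unfolding has_real_derivative_iff_has_vector_derivative[symmetric]
      by (auto intro!: derivative_eq_intros)
    show "((\<lambda>t. L / 6 * norm v ^ 3 * t ^ 3) has_vector_derivative L / 2 * norm v ^ 3 * t\<^sup>2) (at t)"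
      unfolding has_real_derivative_iff_has_vector_derivative[symmetric]
      by (auto intro!: derivative_eq_intros)
  next
    fix t :: real assume "0 < t"
    have "v \<bullet> grad f (x + t *\<^sub>R v) - v \<bullet> grad f x - t * (v \<bullet> ?H)
        = v \<bullet> (grad f (x + t *\<^sub>R v) - grad f x - hessian f x *v (t *\<^sub>R v))"
      by (simp add: inner_diff_right matrix_vector_mult_scaleR)
    then have "norm (v \<bullet> grad f (x + t *\<^sub>R v) - v \<bullet> grad f x - t * (v \<bullet> ?H))
        \<le> norm v * norm (grad f (x + t *\<^sub>R v) - grad f x - hessian f x *v (t *\<^sub>R v))"
      by (simp add: Cauchy_Schwarz_ineq2)
    also have "\<dots> \<le> norm v * (L / 2 * (norm (t *\<^sub>R v))\<^sup>2)"
      by (intro mult_left_mono grad_taylor[OF f L]) simp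
    also have "\<dots> = L / 2 * norm v ^ 3 * t\<^sup>2"
      by (simp add: power2_eq_square power3_eq_cube)
    finally show "norm (v \<bullet> grad f (x + t *\<^sub>R v) - v \<bullet> grad f x - t * (v \<bullet> ?H))
        \<le> L / 2 * norm v ^ 3 * t\<^sup>2" .
  qed simp
  then show ?thesis by (simp add: algebra_simps)
qed

section \<open>Finite-difference errors\<close>

lemma norm_le_sqrt_card:
  fixes v :: "real^'n"
  assumes "\<And>i. \<bar>v $ i\<bar> \<le> c"
  shows "norm v \<le> sqrt (real CARD('n)) * c"
proof -
  \<comment> \<open>Index types are nonempty, so a single entry already forces \<open>c\<close> to
    be nonnegative.\<close>
  have c: "0 \<le> c" using assms[of undefined] by linarith
  have "norm v \<le> L2_set (\<lambda>_::'n. c) UNIV"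
    unfolding norm_vec_def using assms by (intro L2_set_mono) auto
  also have "\<dots> = sqrt (real CARD('n)) * c"
    using c by (simp add: L2_set_def real_sqrt_mult)
  finally show ?thesis .
qed

text \<open>Cauchy-Schwarz on a row costs one factor sqrt n; passing from the components of the
  product to its norm costs the other.\<close>

lemma norm_matrix_vector_entry_le:
  fixes A :: "real^'n^'n"
  assumes "\<And>i j. \<bar>A $ i $ j\<bar> \<le> c"
  shows "norm (A *v v) \<le> real CARD('n) * c * norm v"
proof -
  have "\<bar>(A *v v) $ i\<bar> \<le> sqrt (real CARD('n)) * c * norm v" for i
  proof -
    have "\<bar>(A *v v) $ i\<bar> = \<bar>A $ i \<bullet> v\<bar>" by (simp add: matrix_vector_mul_component)
    also have "\<dots> \<le> norm (A $ i) * norm v" by (rule Cauchy_Schwarz_ineq2)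
    also have "\<dots> \<le> (sqrt (real CARD('n)) * c) * norm v"
      by (intro mult_right_mono norm_le_sqrt_card assms) simp
    finally show ?thesis by simp
  qed
  from norm_le_sqrt_card[of "A *v v", OF this] show ?thesis
    by (simp add: mult.assoc[symmetric])
qed

text \<open>In the central difference the quadratic Taylor terms cancel. Two remainders of size L
  h^3 / 6 are left, and division by 2 h gives L h^2 / 6 per component.\<close>

lemma fd_grad_error:
  fixes f :: "real^'n \<Rightarrow> real"
  assumes f: "C2 f" and L: "lipschitz_hessian L f" and h: "h > 0"
  shows "norm (fd_grad f h x - grad f x) \<le> sqrt (real CARD('n)) * (L * h\<^sup>2 / 6)"
proof (rule norm_le_sqrt_card)
  fix i
  let ?e = "axis i 1 :: real^'n"
  let ?d = "f (x + h *\<^sub>R ?e) - f (x - h *\<^sub>R ?e) - 2 * h * (grad f x $ i)"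
  have g: "?e \<bullet> grad f x = grad f x $ i" by (simp add: inner_axis')
  let ?K = "?e \<bullet> (hessian f x *v ?e)"
  have "\<bar>f (x + h *\<^sub>R ?e) - f x - h * (grad f x $ i) - h * (h * ?K) / 2\<bar> \<le> L / 6 * h ^ 3"
    using taylor2[OF f L, of x "h *\<^sub>R ?e"] h by (simp add: g matrix_vector_mult_scaleR)
  moreover have "\<bar>f (x - h *\<^sub>R ?e) - f x + h * (grad f x $ i) - h * (h * ?K) / 2\<bar> \<le> L / 6 * h ^ 3"
    using taylor2[OF f L, of x "- (h *\<^sub>R ?e)"] h by (simp add: g matrix_vector_mult_scaleR vec.neg)
  ultimately have d: "\<bar>?d\<bar> \<le> L / 3 * h ^ 3" by linarith
  define D where "D = ?d"
  have "(fd_grad f h x - grad f x) $ i = D / (2 * h)"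
    using h by (simp add: D_def fd_grad_def diff_divide_distrib)
  then have "\<bar>(fd_grad f h x - grad f x) $ i\<bar> = \<bar>D\<bar> / (2 * h)"
    using h by (metis abs_divide abs_of_pos mult_pos_pos zero_less_numeral)
  also have "\<dots> \<le> (L / 3 * h ^ 3) / (2 * h)"
    using d h by (intro divide_right_mono) (auto simp: D_def)
  also have "\<dots> = L * h\<^sup>2 / 6" using h by (simp add: power2_eq_square power3_eq_cube)
  finally show "\<bar>(fd_grad f h x - grad f x) $ i\<bar> \<le> L * h\<^sup>2 / 6" .
qed

lemma fd_hess_eq_fd_matrix: "fd_hess f h x = fd_matrix f h x"
  unfolding fd_hess_def fd_matrix_def transpose_def vec_eq_iff
  by (simp add: algebra_simps)

lemma transpose_fd_hess: "transpose (fd_hess f h x) = fd_hess f h x"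
  unfolding fd_hess_def by (simp add: transpose_def vec_eq_iff algebra_simps)

text \<open>
  The mixed difference quotient is differentiated in the direction \<open>i\<close> first, so that it is compared
  with the entry \<open>(i, j)\<close> itself and the symmetry of the Hessian is not needed.
\<close>

lemma fd_matrix_entry_error:
  fixes f :: "real^'n \<Rightarrow> real"
  assumes f: "C2 f" and L: "lipschitz_hessian L f" and h: "h > 0"
  shows "\<bar>(fd_matrix f h x - hessian f x) $ i $ j\<bar> \<le> L * h"
proof -
  let ?a = "axis i 1 :: real^'n" and ?b = "axis j 1 :: real^'n"
  let ?H = "hessian f x $ i $ j"
  have H: "?a \<bullet> (hessian f x *v ?b) = ?H"
    by (simp add: inner_axis' matrix_vector_mult_basis column_def)
  let ?d = "f (x + h *\<^sub>R ?a + h *\<^sub>R ?b) - f (x + h *\<^sub>R ?a) - f (x + h *\<^sub>R ?b) + f x - h\<^sup>2 * ?H"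
  \<comment> \<open>The mixed difference is the increment over [0, h] of the difference of
    \<open>f\<close> along two parallel lines in direction \<open>?a\<close>. Its derivative at
    \<open>s\<close> differs from \<open>h * ?H\<close> by at most L h^2 / 2 (gradient Taylor
    formula at \<open>x + s *\<^sub>R ?a\<close>) plus L h s (moving the Hessian back to
    \<open>x\<close>). Both parts integrate to L h^3 / 2.\<close>
  have "norm ((f ((x + h *\<^sub>R ?b) + h *\<^sub>R ?a) - f (x + h *\<^sub>R ?a) - h * (h * ?H))
      - (f ((x + h *\<^sub>R ?b) + 0 *\<^sub>R ?a) - f (x + 0 *\<^sub>R ?a) - 0 * (h * ?H)))
      \<le> (L * h\<^sup>2 / 2 * h + L * h / 2 * h\<^sup>2) - (L * h\<^sup>2 / 2 * 0 + L * h / 2 * 0\<^sup>2)"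
  proof (rule vector_derivative_bound[where
        f="\<lambda>s. f ((x + h *\<^sub>R ?b) + s *\<^sub>R ?a) - f (x + s *\<^sub>R ?a) - s * (h * ?H)"
        and g="\<lambda>s. L * h\<^sup>2 / 2 * s + L * h / 2 * s\<^sup>2"
        and f'="\<lambda>s. ?a \<bullet> grad f ((x + h *\<^sub>R ?b) + s *\<^sub>R ?a) - ?a \<bullet> grad f (x + s *\<^sub>R ?a) - h * ?H"
        and g'="\<lambda>s. L * h\<^sup>2 / 2 + L * h * s"])
    fix s
    have "((\<lambda>s. f (y + s *\<^sub>R ?a)) has_real_derivative ?a \<bullet> grad f (y + s *\<^sub>R ?a)) (at s)" for y
      using has_vector_derivative_along_line[OF C2_has_derivative[OF f]]
      unfolding has_real_derivative_iff_has_vector_derivative by blast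
    then show "((\<lambda>s. f ((x + h *\<^sub>R ?b) + s *\<^sub>R ?a) - f (x + s *\<^sub>R ?a) - s * (h * ?H)) has_vector_derivative
        ?a \<bullet> grad f ((x + h *\<^sub>R ?b) + s *\<^sub>R ?a) - ?a \<bullet> grad f (x + s *\<^sub>R ?a) - h * ?H) (at s)"
      unfolding has_real_derivative_iff_has_vector_derivative[symmetric]
      by (auto intro!: derivative_eq_intros simp del: add_uminus_conv_diff)
    show "((\<lambda>s. L * h\<^sup>2 / 2 * s + L * h / 2 * s\<^sup>2) has_vector_derivative L * h\<^sup>2 / 2 + L * h * s) (at s)"
      unfolding has_real_derivative_iff_has_vector_derivative[symmetric]
      by (auto intro!: derivative_eq_intros)
  next
    fix s :: real assume s: "0 < s"
    let ?y = "x + s *\<^sub>R ?a"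
    have y: "(x + h *\<^sub>R ?b) + s *\<^sub>R ?a = ?y + h *\<^sub>R ?b" by simp
    have 1: "norm (grad f (?y + h *\<^sub>R ?b) - grad f ?y - hessian f ?y *v (h *\<^sub>R ?b)) \<le> L * h\<^sup>2 / 2"
      using grad_taylor[OF f L, of ?y "h *\<^sub>R ?b"] h by simp
    have 2: "norm (hessian f ?y *v (h *\<^sub>R ?b) - hessian f x *v (h *\<^sub>R ?b)) \<le> L * h * s"
      using lipschitz_hessian_mult[OF L, of ?y "h *\<^sub>R ?b" x] h s by (simp add: mult_ac)
    let ?v = "grad f (?y + h *\<^sub>R ?b) - grad f ?y - hessian f x *v (h *\<^sub>R ?b)"
    have "?a \<bullet> grad f ((x + h *\<^sub>R ?b) + s *\<^sub>R ?a) - ?a \<bullet> grad f ?y - h * ?H = ?a \<bullet> ?v"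
      by (simp add: inner_diff_right matrix_vector_mult_scaleR H y)
    also have "norm \<dots> \<le> norm ?v"
      using Cauchy_Schwarz_ineq2[of ?a ?v] by simp
    also have "\<dots> \<le> L * h\<^sup>2 / 2 + L * h * s"
      using norm_triangle_mono[OF 1 2] by (simp add: algebra_simps)
    finally show "norm (?a \<bullet> grad f ((x + h *\<^sub>R ?b) + s *\<^sub>R ?a) - ?a \<bullet> grad f ?y - h * ?H)
        \<le> L * h\<^sup>2 / 2 + L * h * s" .
  qed (use h in simp)
  then have "\<bar>?d\<bar> \<le> L * h ^ 3"
    by (simp add: algebra_simps power2_eq_square power3_eq_cube)
  moreover have "(fd_matrix f h x - hessian f x) $ i $ j = ?d / h\<^sup>2"
    using h by (simp add: fd_matrix_def diff_divide_distrib)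
  ultimately have "\<bar>(fd_matrix f h x - hessian f x) $ i $ j\<bar> \<le> L * h ^ 3 / h\<^sup>2"
    using h by (simp add: divide_right_mono)
  also have "\<dots> = L * h" using h by (simp add: power2_eq_square power3_eq_cube)
  finally show ?thesis .
qed

lemma fd_hess_error:
  fixes f :: "real^'n \<Rightarrow> real"
  assumes "C2 f" and "lipschitz_hessian L f" and "h > 0"
  shows "norm (hessian f x *v v - fd_hess f h x *v v) \<le> real CARD('n) * (L * h) * norm v"
  using norm_matrix_vector_entry_le[of "fd_matrix f h x - hessian f x" "L * h" v]
    fd_matrix_entry_error[OF assms]
  by (simp add: fd_hess_eq_fd_matrix matrix_vector_mult_diff_rdistrib norm_minus_commute)

section \<open>One cubic step\<close>

lemma has_derivative_norm_cube:
  fixes x :: "'a::real_inner"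
  shows "((\<lambda>x. norm x ^ 3) has_derivative (\<lambda>v. v \<bullet> ((3 * norm x) *\<^sub>R x))) (at x)"
proof (cases "x = 0")
  case True
  have "((\<lambda>v. norm v ^ 3) has_derivative (\<lambda>v. 0)) (at (0::'a))"
  \<comment> \<open>The chain rule through the norm fails at the origin; there the difference
    quotient is squeezed by the squared norm.\<close>
  proof (rule has_derivativeI_sandwich[of 1 _ _ _ _ "\<lambda>v. (norm v)\<^sup>2"])
    have "((\<lambda>v::'a. (norm v)\<^sup>2) \<longlongrightarrow> (norm (0::'a))\<^sup>2) (at 0)"
      by (intro tendsto_intros)
    then show "((\<lambda>v::'a. (norm v)\<^sup>2) \<longlongrightarrow> 0) (at 0)" by simp
  qed (auto simp: power2_eq_square power3_eq_cube)
  with True show ?thesis by simp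
next
  case False
  have "((\<lambda>x. norm x ^ 3) has_derivative (\<lambda>v. 3 * (v \<bullet> sgn x) * (norm x)\<^sup>2)) (at x)"
    using has_derivative_power[OF GDERIV_norm[OF False, unfolded gderiv_def], of 3]
    by (simp add: mult_ac)
  moreover have "3 * (v \<bullet> sgn x) * (norm x)\<^sup>2 = v \<bullet> ((3 * norm x) *\<^sub>R x)" for v
    using False by (simp add: sgn_div_norm power2_eq_square)
  ultimately show ?thesis by simp
qed

text \<open>Symmetry of \<open>B\<close> makes the two product-rule terms of the quadratic form
  equal, which absorbs the factor 1/2.\<close>

lemma grad_cubic_model:
  fixes B :: "real^'n^'n"
  assumes B: "transpose B = B"
  shows "grad (cubic_model c g B \<sigma> x) y = g + B *v (y - x) + (\<sigma> / 2 * norm (y - x)) *\<^sub>R (y - x)"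
proof (rule grad_eqI)
  have sym: "(B *v a) \<bullet> b = a \<bullet> (B *v b)" for a b
    by (metis B dot_lmul_matrix vector_transpose_matrix)
  have N: "((\<lambda>y. norm (y - x) ^ 3) has_derivative (\<lambda>v. v \<bullet> ((3 * norm (y - x)) *\<^sub>R (y - x)))) (at y)"
    by (rule has_derivative_compose[OF _ has_derivative_norm_cube, of "\<lambda>y. y - x" "\<lambda>v. v"])
      (auto intro!: derivative_eq_intros)
  have M: "((\<lambda>y. B *v (y - x)) has_derivative (\<lambda>v. B *v v)) (at y)"
    by (rule bounded_linear.has_derivative[OF matrix_vector_mul_bounded_linear])
      (auto intro!: derivative_eq_intros)
  have "((\<lambda>y. (B *v (y - x)) \<bullet> (y - x)) has_derivative
      (\<lambda>v. (B *v (y - x)) \<bullet> v + (B *v v) \<bullet> (y - x))) (at y)"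
    by (intro has_derivative_inner M) (auto intro!: derivative_eq_intros)
  moreover have "(B *v (y - x)) \<bullet> v + (B *v v) \<bullet> (y - x) = 2 * (v \<bullet> (B *v (y - x)))" for v
    using sym[of v "y - x"] inner_commute[of "B *v (y - x)" v] by linarith
  ultimately have Q: "((\<lambda>y. (B *v (y - x)) \<bullet> (y - x)) has_derivative
      (\<lambda>v. 2 * (v \<bullet> (B *v (y - x))))) (at y)" by simp
  have G: "((\<lambda>y. g \<bullet> (y - x)) has_derivative (\<lambda>v. g \<bullet> v)) (at y)"
    by (auto intro!: derivative_eq_intros)
  show "(cubic_model c g B \<sigma> x has_derivative
      (\<lambda>v. v \<bullet> (g + B *v (y - x) + (\<sigma> / 2 * norm (y - x)) *\<^sub>R (y - x)))) (at y)"
    unfolding cubic_model_def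
    by (rule has_derivative_eq_rhs,
        (rule has_derivative_add has_derivative_const has_derivative_mult_right Q G N)+)
      (simp add: fun_eq_iff inner_add_right inner_commute)
qed


text \<open>
  The inequality of one step in units with \<open>\<sigma> = \<epsilon> = 1\<close>: \<open>r\<close> is the step length and \<open>u\<close> is the
  error caused by using the Hessian of the starting point instead of the current one.
\<close>

lemma scaled_step_inequality:
  fixes r u :: real
  assumes r: "0 \<le> r" and u: "0 \<le> u" and g: "1 \<le> 19/24 * r\<^sup>2 + 1/72 + (1/32 + u) * r"
  shows "1/384 + r ^ 3 / 20 - 432/5 * u ^ 3 \<le> 11/72 * r ^ 3 - r / 72 - (1/32 + u) * r\<^sup>2 / 2"
proof -
  \<comment> \<open>A weighted Young inequality: the polynomial has a double zero at
    \<open>r = 10 * u\<close>, and its other factor makes the terms in r u^2 cancel.\<close>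
  have "0 \<le> (r - 10 * u)\<^sup>2 * (2 * r + 10 * u)" using r u by simp
  then have young: "u * r\<^sup>2 / 2 \<le> r ^ 3 / 30 + 50/3 * u ^ 3"
    by (simp add: power2_eq_square power3_eq_cube algebra_simps)
  \<comment> \<open>The budget left by Young: 11/72 - 1/20 - 1/30 = 5/72 and 432/5 - 50/3 =
    1046/15.\<close>
  have "1/384 + r / 72 + r\<^sup>2 / 64 \<le> 5/72 * r ^ 3 + 1046/15 * u ^ 3"
  proof (cases "1 \<le> r")
    case True
    then have "1 \<le> r ^ 3" "r \<le> r ^ 3" "r\<^sup>2 \<le> r ^ 3"
      using power_increasing[of 1 3 r] power_increasing[of 2 3 r] by auto
    moreover have "0 \<le> u ^ 3" using u by simp
    ultimately show ?thesis by linarith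
  next
    case False
    then have "r\<^sup>2 \<le> 1" "u * r \<le> u" using r u by (auto simp: power_le_one mult_left_le)
    \<comment> \<open>For \<open>r\<close> below 1 the gradient bound forces \<open>u\<close> to be
      at least 1 - 19/24 - 1/72 - 1/32, about 0.163; then the term in u^3 alone pays for the
      left-hand side.\<close>
    then have "16/100 \<le> u" using g False by (simp add: algebra_simps)
    then have "(16/100) ^ 3 \<le> u ^ 3" by (intro power_mono) auto
    moreover have "0 \<le> r ^ 3" using r by simp
    ultimately show ?thesis using False \<open>r\<^sup>2 \<le> 1\<close> by (simp add: power3_eq_cube)
  qed
  moreover have "(1/32 + u) * r\<^sup>2 / 2 = r\<^sup>2 / 64 + u * r\<^sup>2 / 2" by (simp add: algebra_simps)
  ultimately show ?thesis using young by linarith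
qed

lemma cubic_step_edom: "cubic_step f \<psi> B \<sigma> m \<epsilon> x y s \<Longrightarrow> y \<in> edom \<psi>"
  by (simp add: cubic_step_def Let_def)

lemma cubic_step_subdiff: "cubic_step f \<psi> B \<sigma> m \<epsilon> x y s \<Longrightarrow> s \<in> subdiff \<psi> y"
  by (simp add: cubic_step_def Let_def)

text \<open>Only meaningful on the domain of \<open>\<psi>\<close>: elsewhere \<open>real_of_ereal \<infinity> = 0\<close>.\<close>

definition real_obj :: "('a \<Rightarrow> real) \<Rightarrow> ('a \<Rightarrow> ereal) \<Rightarrow> 'a \<Rightarrow> real" where
  "real_obj f \<psi> x = f x + real_of_ereal (\<psi> x)"

lemma psi_eq_ereal:
  assumes "proper_closed_convex \<psi>" and "x \<in> edom \<psi>"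
  shows "\<psi> x = ereal (real_of_ereal (\<psi> x))"
  using assms by (cases "\<psi> x") (auto simp: proper_closed_convex_def edom_def)

lemma obj_eq_real_obj:
  assumes "proper_closed_convex \<psi>" and "x \<in> edom \<psi>"
  shows "obj f \<psi> x = ereal (real_obj f \<psi> x)"
  unfolding obj_def real_obj_def by (subst psi_eq_ereal[OF assms]) simp

text \<open>Non-stationarity of \<open>y\<close> bounds the gradient there from below, which is the
  hypothesis of \<open>scaled_step_inequality\<close> up to scaling. The right-hand side of that
  inequality is the decrease guaranteed by the model after subtracting the gradient, Hessian and
  Taylor errors.\<close>

lemma cubic_step_decrease:
  fixes f :: "real^'n \<Rightarrow> real"
  assumes f: "C2 f" "lipschitz_hessian L f" and \<psi>: "proper_closed_convex \<psi>"
    and B: "transpose B = B"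
    and step: "cubic_step f \<psi> B \<sigma> m \<epsilon> x y s"
    and x: "x \<in> edom \<psi>"
    and pos: "\<sigma> > 0" "E > 0" "0 \<le> L" "0 \<le> d" and eps: "\<epsilon> = \<sigma> * E\<^sup>2"
    and L12: "12 * L \<le> \<sigma>"
    and gerr: "norm (fd_grad f (grad_step CARD('n) \<sigma> m \<epsilon>) x - grad f x) \<le> \<epsilon> / 72"
    and herr: "\<And>v. norm (hessian f x *v v - B *v v) \<le> (\<sigma> * E / 32 + L * d) * norm v"
    and big: "norm (grad f y + s) > \<epsilon>"
  shows "\<sigma> * E ^ 3 / 384 + \<sigma> * (norm (y - x) ^ 3 / 20 - 432/5 * (L / \<sigma> * d) ^ 3)
      \<le> real_obj f \<psi> x - real_obj f \<psi> y"
proof -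
  define g where "g = fd_grad f (grad_step CARD('n) \<sigma> m \<epsilon>) x"
  define v where "v = y - x"
  define \<rho> where "\<rho> = norm v"
  define H where "H = hessian f x *v v"
  define q where "q = \<sigma> * E / 32 + L * d"
  have y: "y = x + v" by (simp add: v_def)
  have yd: "y \<in> edom \<psi>" using step by (rule cubic_step_edom)
  have \<rho>: "0 \<le> \<rho>" by (simp add: \<rho>_def)
  have gerr': "norm (g - grad f x) \<le> \<epsilon> / 72" using gerr by (simp add: g_def)
  have herr': "norm (H - B *v v) \<le> q * \<rho>" using herr[of v] by (simp add: H_def q_def \<rho>_def)
  \<comment> \<open>Used with exponent 2, where 1/24 + 1/4 + 1/2 = 19/24, and with exponent 3, where
    1/6 - 1/72 = 11/72.\<close>
  have L\<rho>: "L * \<rho> ^ k \<le> \<sigma> / 12 * \<rho> ^ k" for k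
    using L12 \<rho> by (intro mult_right_mono) auto
  have M: "cubic_model (f x) g B \<sigma> x y + real_of_ereal (\<psi> y) \<le> f x + real_of_ereal (\<psi> x)"
    using step psi_eq_ereal[OF \<psi> x] psi_eq_ereal[OF \<psi> yd]
    unfolding cubic_step_def Let_def g_def[symmetric] obj_def
    by (metis ereal_less_eq(3) plus_ereal.simps(1))
  have res: "norm (g + B *v v + (\<sigma> / 2 * \<rho>) *\<^sub>R v + s) \<le> \<sigma> / 4 * \<rho>\<^sup>2"
    using step grad_cubic_model[OF B, of "f x" g \<sigma> x y]
    unfolding cubic_step_def Let_def g_def[symmetric] by (simp add: v_def \<rho>_def)
  have "\<epsilon> < norm (grad f y + s)" by (rule big)
  also have "grad f y + s = (grad f (x + v) - grad f x - H) + ((H - B *v v) - (g - grad f x))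
      + ((g + B *v v + (\<sigma> / 2 * \<rho>) *\<^sub>R v + s) - (\<sigma> / 2 * \<rho>) *\<^sub>R v)"
    by (simp add: y)
  also have "norm \<dots> \<le> (L / 2 * \<rho>\<^sup>2 + (q * \<rho> + \<epsilon> / 72)) + (\<sigma> / 4 * \<rho>\<^sup>2 + \<sigma> / 2 * \<rho>\<^sup>2)"
  proof -
    have tri: "norm (a + (b - c) + (d - e)) \<le> (norm a + (norm b + norm c)) + (norm d + norm e)"
      for a b c d e :: "real^'n"
      using norm_triangle_ineq[of "a + (b - c)" "d - e"] norm_triangle_ineq[of a "b - c"]
        norm_triangle_ineq4[of b c] norm_triangle_ineq4[of d e] by linarith
    have P: "norm (grad f (x + v) - grad f x - H) \<le> L / 2 * \<rho>\<^sup>2"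
      using grad_taylor[OF f] by (simp add: H_def \<rho>_def)
    have R: "norm ((\<sigma> / 2 * \<rho>) *\<^sub>R v) \<le> \<sigma> / 2 * \<rho>\<^sup>2"
      using pos by (simp add: \<rho>_def power2_eq_square)
    show ?thesis by (intro order_trans[OF tri] add_mono P R gerr' herr' res)
  qed
  finally have le: "\<epsilon> \<le> \<sigma> * (19/24 * \<rho>\<^sup>2) + \<epsilon> / 72 + q * \<rho>"
    using L\<rho>[of 2] by (simp add: algebra_simps)
  \<comment> \<open>Lengths are measured in units of \<open>E\<close> and \<open>L * d\<close> in
    units of \<open>\<sigma> * E\<close>, so that \<open>\<epsilon> = \<sigma> * E\<^sup>2\<close>
    factors out.\<close>
  define w where "w = \<rho> / E"
  define z where "z = L / \<sigma> * d / E"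
  have w: "\<rho> = E * w" "0 \<le> w" and z: "L / \<sigma> * d = E * z" "L * d = \<sigma> * (E * z)" "0 \<le> z"
    using pos \<rho> by (simp_all add: w_def z_def)
  have "\<sigma> * E\<^sup>2 * 1 \<le> \<sigma> * E\<^sup>2 * (19/24 * w\<^sup>2 + 1/72 + (1/32 + z) * w)"
    using le unfolding eps q_def z w(1) by (simp add: algebra_simps power2_eq_square)
  then have "1 \<le> 19/24 * w\<^sup>2 + 1/72 + (1/32 + z) * w"
    using pos mult_le_cancel_left_pos[of "\<sigma> * E\<^sup>2"] by simp
  with w z have "1/384 + w ^ 3 / 20 - 432/5 * z ^ 3 \<le> 11/72 * w ^ 3 - w / 72 - (1/32 + z) * w\<^sup>2 / 2"
    by (intro scaled_step_inequality)
  from mult_left_mono[OF this, of "\<sigma> * E ^ 3"]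
  have "\<sigma> * E ^ 3 / 384 + \<sigma> * (\<rho> ^ 3 / 20 - 432/5 * (L / \<sigma> * d) ^ 3)
      \<le> 11/72 * \<sigma> * \<rho> ^ 3 - \<epsilon> / 72 * \<rho> - q * \<rho>\<^sup>2 / 2"
    using pos unfolding eps q_def z w(1)
    by (simp add: algebra_simps power2_eq_square power3_eq_cube)
  \<comment> \<open>By \<open>M\<close> the model at \<open>y\<close> does not exceed the objective
    at \<open>x\<close>. Trading the model for \<open>f y\<close> costs
    \<open>\<epsilon> / 72 * \<rho>\<close> for the gradient, half of
    \<open>q * \<rho>\<^sup>2\<close> for the Hessian and \<open>L / 6 * \<rho> ^ 3\<close> for the
    Taylor remainder.\<close>
  moreover have "11/72 * \<sigma> * \<rho> ^ 3 - \<epsilon> / 72 * \<rho> - q * \<rho>\<^sup>2 / 2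
      \<le> real_obj f \<psi> x - real_obj f \<psi> y"
  proof -
    have "f y - f x \<le> v \<bullet> grad f x + v \<bullet> H / 2 + L / 6 * \<rho> ^ 3"
      using taylor2[OF f, of x v] unfolding H_def y \<rho>_def by linarith
    moreover have "v \<bullet> (grad f x - g) \<le> \<rho> * (\<epsilon> / 72)"
      using norm_cauchy_schwarz[of v "grad f x - g"] mult_left_mono[OF gerr' \<rho>]
      by (simp add: \<rho>_def norm_minus_commute)
    moreover have "v \<bullet> (H - B *v v) \<le> \<rho> * (q * \<rho>)"
      using norm_cauchy_schwarz[of v "H - B *v v"] mult_left_mono[OF herr' \<rho>]
      by (simp add: \<rho>_def)
    moreover have "cubic_model (f x) g B \<sigma> x y = f x + v \<bullet> g + v \<bullet> (B *v v) / 2 + \<sigma> / 6 * \<rho> ^ 3"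
      by (simp add: cubic_model_def v_def \<rho>_def inner_commute)
    ultimately show ?thesis
      using M L\<rho>[of 3] by (simp add: real_obj_def inner_diff_right algebra_simps power2_eq_square)
  qed
  ultimately show ?thesis by (simp add: \<rho>_def v_def)
qed

section \<open>A block of cubic steps with a frozen Hessian\<close>

text \<open>On nonnegative reals the cube lies above its tangent at the mean \<open>c\<close>;
  summing the tangent inequalities gives the power mean inequality.\<close>

lemma sum_cube_le:
  fixes a :: "nat \<Rightarrow> real"
  assumes a: "\<And>i. i < n \<Longrightarrow> 0 \<le> a i"
  shows "(\<Sum>i<n. a i) ^ 3 \<le> real n ^ 2 * (\<Sum>i<n. a i ^ 3)"
proof (cases "n = 0")
  case False
  define c where "c = (\<Sum>i<n. a i) / real n"
  have c: "0 \<le> c" unfolding c_def using a by (auto intro!: divide_nonneg_nonneg sum_nonneg)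
  have S: "(\<Sum>i<n. a i) = real n * c" using False by (simp add: c_def)
  have tangent: "3 * c\<^sup>2 * a i - 2 * c ^ 3 \<le> a i ^ 3" if "i < n" for i
  proof -
    have "0 \<le> (a i - c)\<^sup>2 * (a i + 2 * c)" using a[OF that] c by simp
    then show ?thesis by (simp add: power2_eq_square power3_eq_cube algebra_simps)
  qed
  have "(\<Sum>i<n. 3 * c\<^sup>2 * a i - 2 * c ^ 3) \<le> (\<Sum>i<n. a i ^ 3)"
    using tangent by (intro sum_mono) auto
  also have "(\<Sum>i<n. 3 * c\<^sup>2 * a i - 2 * c ^ 3) = real n * c ^ 3"
    by (simp add: sum_subtractf sum_distrib_left[symmetric] S power2_eq_square power3_eq_cube)
  finally have "real n ^ 2 * (real n * c ^ 3) \<le> real n ^ 2 * (\<Sum>i<n. a i ^ 3)"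
    by (intro mult_left_mono) auto
  then show ?thesis by (simp add: S power2_eq_square power3_eq_cube mult_ac)
qed simp

text \<open>The displacement from the start is paid for by the cubed step lengths.\<close>

lemma sum_displacement_cube_le:
  fixes x :: "nat \<Rightarrow> 'a::real_normed_vector"
  assumes n: "n \<le> m" and c: "0 \<le> c" "12 * c * real m \<le> 1"
  shows "0 \<le> (\<Sum>t<n. norm (x (t + 1) - x t) ^ 3 / 20 - 432/5 * (c * norm (x t - x 0)) ^ 3)"
proof -
  let ?r = "\<lambda>t. norm (x (t + 1) - x t)"
  define S where "S = (\<Sum>t<n. ?r t ^ 3)"
  have S: "0 \<le> S" by (simp add: S_def sum_nonneg)
  have "norm (x t - x 0) ^ 3 \<le> real m ^ 2 * S" if "t < n" for t
  proof -
    \<comment> \<open>The displacement telescopes into at most \<open>m\<close> steps, to whose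
      lengths the power mean inequality applies.\<close>
    have "norm (x t - x 0) = norm (\<Sum>i<t. x (Suc i) - x i)" by (simp add: sum_lessThan_telescope)
    also have "\<dots> \<le> (\<Sum>i<t. ?r i)" using norm_sum[of "\<lambda>i. x (Suc i) - x i" "{..<t}"] by simp
    finally have "norm (x t - x 0) ^ 3 \<le> (\<Sum>i<t. ?r i) ^ 3" by (intro power_mono) auto
    also have "\<dots> \<le> real t ^ 2 * (\<Sum>i<t. ?r i ^ 3)" by (rule sum_cube_le) simp
    also have "\<dots> \<le> real m ^ 2 * S"
      unfolding S_def using that n by (intro mult_mono power_mono sum_mono2) (auto intro: sum_nonneg)
    finally show ?thesis .
  qed
  then have "(\<Sum>t<n. norm (x t - x 0) ^ 3) \<le> real n * (real m ^ 2 * S)"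
    using sum_bounded_above[of "{..<n}" "\<lambda>t. norm (x t - x 0) ^ 3" "real m ^ 2 * S"] by simp
  also have "\<dots> \<le> real m * (real m ^ 2 * S)" using n S by (intro mult_right_mono) auto
  finally have "c ^ 3 * (\<Sum>t<n. norm (x t - x 0) ^ 3) \<le> c ^ 3 * (real m * (real m ^ 2 * S))"
    using c by (intro mult_left_mono) auto
  \<comment> \<open>This is where 432/5 = 1728/20 comes from: the displacement terms then use up at
    most \<open>S / 20\<close>, the whole sum of the first terms.\<close>
  also have "\<dots> = (12 * c * real m) ^ 3 * (S / 1728)"
    by (simp add: power2_eq_square power3_eq_cube)
  also have "\<dots> \<le> 1 * (S / 1728)"
    using c S by (intro mult_right_mono power_le_one) auto
  finally have "c ^ 3 * (\<Sum>t<n. norm (x t - x 0) ^ 3) \<le> S / 1728" by simp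
  moreover have "(\<Sum>t<n. ?r t ^ 3 / 20 - 432/5 * (c * norm (x t - x 0)) ^ 3)
      = S / 20 - 432/5 * (c ^ 3 * (\<Sum>t<n. norm (x t - x 0) ^ 3))"
    by (simp add: S_def sum_subtractf sum_divide_distrib sum_distrib_left power_mult_distrib mult_ac)
  ultimately show ?thesis by simp
qed

section \<open>Parameter choices and the error levels they guarantee\<close>

lemma reg_param_pos: "0 < \<tau> \<Longrightarrow> 1 \<le> m \<Longrightarrow> 0 < reg_param \<tau> l m"
  by (simp add: reg_param_def)

text \<open>Since (3/4)^3 = 27/64 is below 2/3, the factor 16 (2/3)^(1/3) is at least 12. With the
  factor \<open>m\<close> the bound covers the displacement over a whole block; dropping
  \<open>m\<close> gives the bound for one step.\<close>

lemma reg_param_ge: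
  assumes "0 \<le> L" and "L \<le> 2 ^ l * \<tau>"
  shows "12 * (L * real m) \<le> reg_param \<tau> l m"
proof -
  define \<kappa> :: real where "\<kappa> = (2/3) powr (1/3)"
  have "\<kappa> ^ 3 = 2/3" by (simp add: \<kappa>_def powr_power)
  then have "(3/4) ^ 3 \<le> \<kappa> ^ 3" by (simp add: power3_eq_cube)
  then have "3/4 \<le> \<kappa>"
    unfolding numeral_3_eq_3 by (rule power_le_imp_le_base) (simp add: \<kappa>_def)
  then have "12 * L \<le> 16 * \<kappa> * (2 ^ l * \<tau>)"
    using mult_mono[of 12 "16 * \<kappa>" L "2 ^ l * \<tau>"] assms by simp
  then have "12 * L * real m \<le> 16 * \<kappa> * (2 ^ l * \<tau>) * real m" by (rule mult_right_mono) simp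
  then show ?thesis by (simp add: reg_param_def \<kappa>_def mult_ac)
qed

lemma grad_step_pos:
  assumes "0 < \<sigma>" and "0 < \<epsilon>" and "1 \<le> m" and "1 \<le> n"
  shows "0 < grad_step n \<sigma> m \<epsilon>"
  using assms by (simp add: grad_step_def)

text \<open>The squared step is at most \<epsilon> m / (\<sigma> sqrt n), as 1 / 3^(1/3) is at most
  1. Then sqrt n cancels, and L m \<epsilon> / (6 \<sigma>) is at most \<epsilon> / 72.\<close>

lemma grad_step_error:
  assumes "0 < \<sigma>" and "0 < \<epsilon>" and "1 \<le> m" and "1 \<le> n" and "0 \<le> L"
    and L: "12 * (L * real m) \<le> \<sigma>"
  shows "sqrt (real n) * (L * (grad_step n \<sigma> m \<epsilon>)\<^sup>2 / 6) \<le> \<epsilon> / 72"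
proof -
  define X where "X = \<epsilon> * real m / (\<sigma> * real n powr (1/2))"
  have X: "0 < X" using assms by (simp add: X_def)
  have "1 \<le> (3::real) powr (1/3)" by (rule ge_one_powr_ge_zero) auto
  then have "1 / 3 powr (1/3) * X powr (1/2) \<le> 1 * X powr (1/2)"
    by (intro mult_right_mono) auto
  then have "(grad_step n \<sigma> m \<epsilon>)\<^sup>2 \<le> (X powr (1/2))\<^sup>2"
    unfolding grad_step_def X_def[symmetric] by (intro power_mono) auto
  also have "\<dots> = X" using X by (simp add: powr_half_sqrt)
  finally have "sqrt (real n) * (L * (grad_step n \<sigma> m \<epsilon>)\<^sup>2 / 6) \<le> sqrt (real n) * (L * X / 6)"
    using assms by (intro mult_left_mono divide_right_mono) auto
  also have "\<dots> = (12 * (L * real m)) / \<sigma> * (\<epsilon> / 72)"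
    using assms by (simp add: X_def powr_half_sqrt field_simps)
  also have "\<dots> \<le> 1 * (\<epsilon> / 72)"
    using assms by (intro mult_right_mono) auto
  finally show ?thesis by simp
qed

lemma hess_step_pos:
  assumes "0 < \<tau>" and "0 < \<epsilon>" and "1 \<le> m" and "1 \<le> n"
  shows "0 < hess_step n \<tau> l m \<epsilon>"
  using assms reg_param_pos[of \<tau> m l] by (simp add: hess_step_def)

text \<open>Comparing cubes undoes the cube root in \<open>hess_step\<close>. With
  \<open>2 ^ l * \<tau>\<close> in place of \<open>L\<close>, the cube of the left-hand side is 81 /
  (2^14 * 192) times that of \<open>\<sigma> * sqrt (\<epsilon> / \<sigma>)\<close>, and 1 / 32^3 =
  96 / (2^14 * 192).\<close>

lemma hess_step_error:
  assumes pos: "0 < \<tau>" "0 < \<epsilon>" "1 \<le> m" "1 \<le> n" and L: "0 \<le> L" "L \<le> 2 ^ l * \<tau>"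
  shows "real n * (L * hess_step n \<tau> l m \<epsilon>)
      \<le> reg_param \<tau> l m * sqrt (\<epsilon> / reg_param \<tau> l m) / 32"
proof -
  define \<sigma> where "\<sigma> = reg_param \<tau> l m"
  define h where "h = hess_step n \<tau> l m \<epsilon>"
  have \<sigma>: "0 < \<sigma>" unfolding \<sigma>_def using pos by (intro reg_param_pos)
  have h: "0 < h" unfolding h_def using pos by (intro hess_step_pos)
  have "\<sigma> * sqrt (\<epsilon> / \<sigma>) = sqrt (\<sigma> * \<epsilon>)"
    using \<sigma> pos by (simp add: real_sqrt_divide real_sqrt_mult real_div_sqrt field_simps)
  then have cube: "(\<sigma> * sqrt (\<epsilon> / \<sigma>)) ^ 3 = \<sigma> powr (3/2) * \<epsilon> powr (3/2)"
    using \<sigma> pos by (simp add: powr_half_sqrt[symmetric] powr_power powr_mult power_mult_distrib)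
  have "h ^ 3 = 3 ^ 4 * \<sigma> powr (3/2) * \<epsilon> powr (3/2) / (2 ^ 14 * 192 * real n ^ 3 * (2 ^ l * \<tau>) ^ 3)"
    using \<sigma> pos unfolding h_def hess_step_def \<sigma>_def[symmetric] by (simp add: powr_power)
  then have "(real n * (2 ^ l * \<tau> * h)) ^ 3 = 81 / (2 ^ 14 * 192) * (\<sigma> * sqrt (\<epsilon> / \<sigma>)) ^ 3"
    unfolding cube using pos by (simp add: power_mult_distrib)
  also have "\<dots> \<le> (\<sigma> * sqrt (\<epsilon> / \<sigma>) / 32) ^ 3"
    using \<sigma> pos by (simp add: power_divide)
  finally have "real n * (2 ^ l * \<tau> * h) \<le> \<sigma> * sqrt (\<epsilon> / \<sigma>) / 32"
    unfolding numeral_3_eq_3 by (rule power_le_imp_le_base) (use \<sigma> pos in auto)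
  moreover have "real n * (L * h) \<le> real n * (2 ^ l * \<tau> * h)"
    using L h by (intro mult_left_mono mult_right_mono) auto
  ultimately show ?thesis unfolding \<sigma>_def h_def by linarith
qed

text \<open>This turns the threshold of \<open>decrease_test\<close> into the units of a single
  step.\<close>

lemma decrease_amount:
  assumes "0 < \<sigma>" and "0 < \<epsilon>"
  shows "\<epsilon> powr (3/2) / (384 * \<sigma> powr (1/2)) = \<sigma> * sqrt (\<epsilon> / \<sigma>) ^ 3 / 384"
proof -
  have "\<epsilon> powr (3/2) = sqrt \<epsilon> ^ 3"
    using assms by (simp add: powr_half_sqrt[symmetric] powr_power)
  moreover have "\<sigma> * sqrt \<sigma> = sqrt \<sigma> ^ 3"
    using assms by (simp add: power3_eq_cube)
  ultimately show ?thesis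
    using assms by (simp add: powr_half_sqrt real_sqrt_divide power_divide field_simps)
qed

text \<open>The matrix stays that of \<open>x 0\<close>, so at step \<open>t\<close> its error is
  the finite-difference error plus \<open>L\<close> times the distance from \<open>x 0\<close>.
  Summing \<open>cubic_step_decrease\<close> leaves distance terms whose total
  \<open>sum_displacement_cube_le\<close> shows to be nonnegative.\<close>

lemma cubic_steps_decrease:
  fixes f :: "real^'n \<Rightarrow> real"
  assumes f: "C2 f" "lipschitz_hessian L f" and \<psi>: "proper_closed_convex \<psi>" and x0: "x 0 \<in> edom \<psi>"
    and pos: "0 < \<tau>" "0 < \<epsilon>" "1 \<le> m" and L: "0 \<le> L" "L \<le> 2 ^ l * \<tau>"
    and \<sigma>_def: "\<sigma> = reg_param \<tau> l m"
    and step: "\<And>t. t < n \<Longrightarrow>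
      cubic_step f \<psi> (fd_hess f (hess_step CARD('n) \<tau> l m \<epsilon>) (x 0)) \<sigma> m \<epsilon> (x t) (x (t + 1)) (s (t + 1))"
    and big: "\<And>t. t < n \<Longrightarrow> \<epsilon> < norm (grad f (x (t + 1)) + s (t + 1))"
    and n: "n \<le> m"
  shows "\<epsilon> powr (3/2) / (384 * \<sigma> powr (1/2)) * real n \<le> real_obj f \<psi> (x 0) - real_obj f \<psi> (x n)"
proof -
  define E where "E = sqrt (\<epsilon> / \<sigma>)"
  define B where "B = fd_hess f (hess_step CARD('n) \<tau> l m \<epsilon>) (x 0)"
  let ?d = "\<lambda>t. norm (x t - x 0)"
  have \<sigma>: "0 < \<sigma>" unfolding \<sigma>_def using pos by (intro reg_param_pos)
  have E: "0 < E" "\<epsilon> = \<sigma> * E\<^sup>2" using \<sigma> pos by (auto simp: E_def)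
  have Lm: "12 * (L * real m) \<le> \<sigma>" unfolding \<sigma>_def by (rule reg_param_ge[OF L])
  have card: "1 \<le> CARD('n)" by simp
  have xd: "x t \<in> edom \<psi>" if "t \<le> n" for t
    using x0 cubic_step_edom[OF step[of "t - 1"]] that by (cases t) auto
  have one: "\<sigma> * E ^ 3 / 384 + \<sigma> * (norm (x (t + 1) - x t) ^ 3 / 20 - 432/5 * (L / \<sigma> * ?d t) ^ 3)
      \<le> real_obj f \<psi> (x t) - real_obj f \<psi> (x (t + 1))" if t: "t < n" for t
  proof (rule cubic_step_decrease[OF f \<psi> _ step[OF t]])
    show "transpose (fd_hess f (hess_step CARD('n) \<tau> l m \<epsilon>) (x 0))
        = fd_hess f (hess_step CARD('n) \<tau> l m \<epsilon>) (x 0)"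
      by (rule transpose_fd_hess)
    have "12 * L * 1 \<le> 12 * L * real m" using L pos by (intro mult_left_mono) auto
    then show "12 * L \<le> \<sigma>" using Lm by simp
    have "norm (fd_grad f (grad_step CARD('n) \<sigma> m \<epsilon>) (x t) - grad f (x t))
        \<le> sqrt (real CARD('n)) * (L * (grad_step CARD('n) \<sigma> m \<epsilon>)\<^sup>2 / 6)"
      by (rule fd_grad_error[OF f grad_step_pos[OF \<sigma> pos(2,3) card]])
    also have "\<dots> \<le> \<epsilon> / 72"
      by (rule grad_step_error[OF \<sigma> pos(2,3) card L(1) Lm])
    finally show "norm (fd_grad f (grad_step CARD('n) \<sigma> m \<epsilon>) (x t) - grad f (x t)) \<le> \<epsilon> / 72" .
    fix v
    have "norm (hessian f (x 0) *v v - B *v v) \<le> \<sigma> * E / 32 * norm v"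
    proof -
      have "norm (hessian f (x 0) *v v - B *v v)
          \<le> real CARD('n) * (L * hess_step CARD('n) \<tau> l m \<epsilon>) * norm v"
        unfolding B_def by (rule fd_hess_error[OF f hess_step_pos[OF pos card]])
      also have "\<dots> \<le> \<sigma> * E / 32 * norm v"
        using hess_step_error[OF pos card L] by (intro mult_right_mono) (auto simp: E_def \<sigma>_def)
      finally show ?thesis .
    qed
    from norm_triangle_mono[OF lipschitz_hessian_mult[OF f(2), of "x t" v "x 0"] this]
    show "norm (hessian f (x t) *v v - fd_hess f (hess_step CARD('n) \<tau> l m \<epsilon>) (x 0) *v v)
        \<le> (\<sigma> * E / 32 + L * ?d t) * norm v"
      by (simp add: B_def algebra_simps)
  qed (use \<sigma> E L xd t big in auto)
  have "0 \<le> (\<Sum>t<n. norm (x (t + 1) - x t) ^ 3 / 20 - 432/5 * (L / \<sigma> * ?d t) ^ 3)"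
    using L \<sigma> Lm by (intro sum_displacement_cube_le[OF n]) (auto simp: field_simps)
  then have "\<sigma> * E ^ 3 / 384 * real n \<le> \<sigma> * E ^ 3 / 384 * real n
      + \<sigma> * (\<Sum>t<n. norm (x (t + 1) - x t) ^ 3 / 20 - 432/5 * (L / \<sigma> * ?d t) ^ 3)"
    using \<sigma> by simp
  also have "\<dots> = (\<Sum>t<n. \<sigma> * E ^ 3 / 384
      + \<sigma> * (norm (x (t + 1) - x t) ^ 3 / 20 - 432/5 * (L / \<sigma> * ?d t) ^ 3))"
    by (simp only: sum.distrib sum_distrib_left[symmetric] sum_constant card_lessThan) simp
  also have "\<dots> \<le> (\<Sum>t<n. real_obj f \<psi> (x t) - real_obj f \<psi> (x (t + 1)))"
    using one by (intro sum_mono) auto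
  also have "\<dots> = real_obj f \<psi> (x 0) - real_obj f \<psi> (x n)"
    by (induction n) auto
  finally show ?thesis by (simp add: decrease_amount[OF \<sigma> pos(2)] E_def)
qed

lemma zero_order_cubic_steps_edom:
  assumes "zero_order_cubic_steps f \<psi> x B \<sigma> m \<epsilon> c" and "x \<in> edom \<psi>" and "t \<le> steps c"
  shows "iter c t \<in> edom \<psi>"
proof (cases t)
  case (Suc u)
  with assms have "cubic_step f \<psi> B \<sigma> m \<epsilon> (iter c u) (iter c (u + 1)) (subgr c (u + 1))"
    by (simp add: zero_order_cubic_steps_def)
  then show ?thesis using cubic_step_edom Suc by fastforce
qed (use assms in \<open>simp add: zero_order_cubic_steps_def\<close>)

lemma decrease_test_iff:
  assumes "proper_closed_convex \<psi>" and "x \<in> edom \<psi>" and "y \<in> edom \<psi>"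
  shows "decrease_test f \<psi> \<sigma> \<epsilon> x t y \<longleftrightarrow>
    \<epsilon> powr (3/2) / (384 * \<sigma> powr (1/2)) * real (t + 1) \<le> real_obj f \<psi> x - real_obj f \<psi> y"
  using assms by (simp add: decrease_test_def obj_eq_real_obj)

text \<open>A halted call has just failed the decrease test, whereas the block estimate up to its
  last point says that the test holds there.\<close>

lemma call_succeeds:
  fixes f :: "real^'n \<Rightarrow> real"
  assumes f: "C2 f" "lipschitz_hessian L f" and \<psi>: "proper_closed_convex \<psi>" and x: "x \<in> edom \<psi>"
    and pos: "0 < \<tau>" "0 < \<epsilon>" "1 \<le> m" and L: "0 \<le> L" "L \<le> 2 ^ l * \<tau>"
    and call: "zero_order_cubic_steps f \<psi> x (fd_hess f (hess_step CARD('n) \<tau> l m \<epsilon>) x)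
      (reg_param \<tau> l m) m \<epsilon> c"
    and nonstat: "\<And>t. t \<le> steps c \<Longrightarrow> \<not> eps_stationary f \<psi> \<epsilon> c t"
  shows "outcome c = Success"
proof (cases "outcome c")
  case Halt
  define n where "n = steps c"
  have i0: "iter c 0 = x" using call by (simp add: zero_order_cubic_steps_def)
  have n: "1 \<le> n" "n \<le> m"
    and fail: "\<not> decrease_test f \<psi> (reg_param \<tau> l m) \<epsilon> x (n - 1) (iter c n)"
    using call Halt by (auto simp: zero_order_cubic_steps_def n_def)
  have step: "cubic_step f \<psi> (fd_hess f (hess_step CARD('n) \<tau> l m \<epsilon>) (iter c 0)) (reg_param \<tau> l m) m \<epsilon>
      (iter c t) (iter c (t + 1)) (subgr c (t + 1))" if "t < n" for t
    using call that by (simp add: zero_order_cubic_steps_def n_def)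
  have "\<epsilon> < norm (grad f (iter c (t + 1)) + subgr c (t + 1))" if "t < n" for t
    using nonstat[of "t + 1"] cubic_step_subdiff[OF step[OF that]] that
    by (simp add: eps_stationary_def n_def)
  \<comment> \<open>The test with index \<open>n - 1\<close> demands \<open>n\<close> units of
    decrease, which is what \<open>n\<close> steps deliver.\<close>
  from cubic_steps_decrease[where s="subgr c", OF f \<psi> _ pos L refl step this n(2)]
  have "decrease_test f \<psi> (reg_param \<tau> l m) \<epsilon> x (n - 1) (iter c n)"
    using n x i0 decrease_test_iff[OF \<psi> x zero_order_cubic_steps_edom[OF call x, of n]]
    by (simp add: n_def)
  with fail show ?thesis by contradiction
qed

section \<open>The outer loop\<close>

lemma executed_earlier:
  "executed oc k l \<Longrightarrow> l' \<le> l \<Longrightarrow> executed oc k l'"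
proof (induction rule: executed.induct)
  case start
  then show ?case by (simp add: executed.start)
next
  case (retry k l)
  have "executed oc k (l + 1)" using retry.hyps by (rule executed.retry)
  moreover have "l' = l + 1 \<or> l' \<le> l" using retry.prems by linarith
  ultimately show ?case using retry.IH by metis
next
  case (advance k l)
  have "executed oc (k + 1) 0" using advance.hyps by (rule executed.advance)
  moreover have "l' = 0" using advance.prems by simp
  ultimately show ?case by (simp only:)
qed

lemma executed_before_halt:
  assumes "executed oc k l" and "l' < l"
  shows "oc k l' = Halt"
proof -
  have "executed oc k (Suc l')" using executed_earlier[OF assms(1), of "Suc l'"] assms(2) by simp
  then show ?thesis by cases auto
qed

text \<open>This makes the calls of a completed iteration a finite initial segment, as counting
  evaluations requires.\<close>

lemma executed_iff_le:
  assumes "executed oc k l" and "oc k l = Success"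
  shows "executed oc k l' \<longleftrightarrow> l' \<le> l"
  using assms executed_before_halt[of oc k l' l] executed_earlier[of oc k l l']
  by (metis linorder_not_le outcome.distinct(1))

text \<open>Without a success every loop halts and triggers the next one, so loop \<open>b\<close>
  would be reached and succeed.\<close>

lemma executed_find_success:
  assumes "executed oc k 0" and "\<And>l. executed oc k l \<Longrightarrow> b \<le> l \<Longrightarrow> oc k l = Success"
  shows "\<exists>l. executed oc k l \<and> oc k l = Success"
proof (rule ccontr)
  assume none: "\<not> ?thesis"
  have "executed oc k l" for l
  proof (induction l)
    case (Suc l)
    then have "oc k l = Halt" using none by (cases "oc k l") auto
    with Suc show ?case using executed.retry by fastforce
  qed (rule assms(1))
  with assms(2)[of b] none show False by blast
qed

section \<open>Decrease and number of retries per outer iteration\<close>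

text \<open>The reciprocal of the factor of the objective gap in the iteration bound, with
  \<open>N\<close> standing for \<open>max \<tau>0 L\<close>.\<close>

definition iteration_decrease :: "real \<Rightarrow> nat \<Rightarrow> real \<Rightarrow> real" where
  "iteration_decrease \<epsilon> m N
     = \<epsilon> powr (3/2) * sqrt (real m) / (384 * 2 powr (5/2) * (2/3) powr (1/6) * N powr (1/2))"

text \<open>Doubling overshoots \<open>N\<close> by at most a factor 2, so \<sigma> is at most 2^5
  (2/3)^(1/3) N m; its square root yields 2^(5/2) and (2/3)^(1/6).\<close>

lemma iteration_decrease_le:
  assumes pos: "0 < \<tau>" "0 < \<epsilon>" "1 \<le> m" and N: "2 ^ l * \<tau> \<le> 2 * N"
  shows "iteration_decrease \<epsilon> m N \<le> \<epsilon> powr (3/2) / (384 * reg_param \<tau> l m powr (1/2)) * real m"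
proof -
  have "0 < 2 ^ l * \<tau>" using pos by simp
  with N have N0: "0 < N" by linarith
  define D where "D = 2 powr (5/2) * (2/3) powr (1/6) * N powr (1/2)"
  have D: "0 < D" using N0 by (simp add: D_def)
  have "reg_param \<tau> l m \<le> 2 ^ 4 * (2/3) powr (1/3) * (2 * N) * real m"
    unfolding reg_param_def using N by (intro mult_right_mono mult_left_mono) auto
  also have "\<dots> = 2 powr 5 * (2/3) powr (1/3) * N * real m" by simp
  finally have "reg_param \<tau> l m powr (1/2) \<le> (2 powr 5 * (2/3) powr (1/3) * N * real m) powr (1/2)"
    using reg_param_pos[OF pos(1,3), of l] by (intro powr_mono2) auto
  also have "\<dots> = D * sqrt (real m)"
    unfolding D_def powr_mult powr_powr by (simp add: powr_half_sqrt)
  finally have "\<epsilon> powr (3/2) / (384 * (D * sqrt (real m))) * real m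
      \<le> \<epsilon> powr (3/2) / (384 * reg_param \<tau> l m powr (1/2)) * real m"
    using pos D reg_param_pos[OF pos(1,3), of l]
    by (intro mult_right_mono divide_left_mono mult_left_mono mult_pos_pos) auto
  moreover have "\<epsilon> powr (3/2) / (384 * (D * sqrt (real m))) * real m
      = \<epsilon> powr (3/2) / (384 * D) * (real m / sqrt (real m))" by simp
  moreover have "real m / sqrt (real m) = sqrt (real m)" by (rule real_div_sqrt) simp
  ultimately show ?thesis by (simp add: iteration_decrease_def D_def mult_ac)
qed

text \<open>Doubling pushes \<open>2 ^ l * tau r k\<close> above \<open>L\<close>, so some call
  succeeds. If a call halted just before it, that call used a value at most \<open>L\<close>, which
  keeps the next \<open>tau\<close> within its bounds.\<close>

lemma iteration_succeeds:
  fixes f :: "real^'n \<Rightarrow> real" and r :: "(real^'n) cnm_run"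
  assumes f: "C2 f" "lipschitz_hessian L f" and \<psi>: "proper_closed_convex \<psi>"
    and pos: "0 < \<tau>0" "0 < \<epsilon>" "1 \<le> m" and L: "0 \<le> L"
    and run: "zero_order_cnm f \<psi> x0 \<tau>0 \<epsilon> m r"
    and nonstat: "\<And>l t. reached r k l \<Longrightarrow> t \<le> steps (call r k l) \<Longrightarrow> \<not> eps_stationary f \<psi> \<epsilon> (call r k l) t"
    and start: "reached r k 0" and x: "outer r k \<in> edom \<psi>"
    and \<tau>: "\<tau>0 \<le> tau r k" "tau r k \<le> max \<tau>0 L"
  obtains l where "\<And>l'. reached r k l' \<longleftrightarrow> l' \<le> l" and "reached r (Suc k) 0"
    and "outer r (Suc k) \<in> edom \<psi>" and "\<tau>0 \<le> tau r (Suc k)" and "tau r (Suc k) \<le> max \<tau>0 L"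
    and "real l \<le> 1 + log 2 (tau r (Suc k)) - log 2 (tau r k)"
    and "iteration_decrease \<epsilon> m (max \<tau>0 L)
      \<le> real_obj f \<psi> (outer r k) - real_obj f \<psi> (outer r (Suc k))"
proof -
  let ?\<tau> = "tau r k" and ?oc = "\<lambda>k l. outcome (call r k l)"
  have \<tau>0: "0 < ?\<tau>" using pos \<tau> by linarith
  have called: "zero_order_cubic_steps f \<psi> (outer r k)
      (fd_hess f (hess_step CARD('n) ?\<tau> l m \<epsilon>) (outer r k)) (reg_param ?\<tau> l m) m \<epsilon> (call r k l)"
    if "reached r k l" for l
    using run that by (simp add: zero_order_cnm_def)
  have succ: "?oc k l = Success" if "reached r k l" "L \<le> 2 ^ l * ?\<tau>" for l
    using call_succeeds[OF f \<psi> x \<tau>0 pos(2,3) L that(2) called[OF that(1)]] nonstat[OF that(1)] by blast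
  obtain b :: nat where "L / ?\<tau> < 2 ^ b" using real_arch_pow[of 2 "L / ?\<tau>"] by auto
  then have b: "L \<le> 2 ^ b * ?\<tau>" using \<tau>0 by (simp add: field_simps)
  have big: "L \<le> 2 ^ l * ?\<tau>" if "b \<le> l" for l
  proof -
    have "2 ^ b * ?\<tau> \<le> 2 ^ l * ?\<tau>"
      using that \<tau>0 by (intro mult_right_mono power_increasing) auto
    with b show ?thesis by linarith
  qed
  obtain l where l: "reached r k l" "?oc k l = Success"
    using executed_find_success[of ?oc k b] start succ big unfolding reached_def by blast
  have halt: "2 powr (real l - 1) * ?\<tau> \<le> max \<tau>0 L"
  proof (cases l)
    case 0
    have "2 powr (- 1) * ?\<tau> \<le> 1 * ?\<tau>" using \<tau>0 by (intro mult_right_mono) auto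
    with 0 \<tau> show ?thesis by simp
  next
    case (Suc j)
    have "reached r k j" "?oc k j = Halt"
      using l(1) Suc executed_earlier[of ?oc k l j] executed_before_halt[of ?oc k l j]
      by (auto simp: reached_def)
    with succ[of j] have "2 ^ j * ?\<tau> \<le> L" by (metis linorder_le_cases outcome.distinct(1))
    with Suc show ?thesis by (simp add: powr_realpow)
  qed
  have two: "2 ^ l * ?\<tau> \<le> 2 * max \<tau>0 L"
    using halt by (simp add: powr_diff powr_realpow)
  have next_x: "outer r (Suc k) = iter (call r k l) (steps (call r k l))"
    and next_\<tau>: "tau r (Suc k) = max \<tau>0 (2 powr (real l - 1) * ?\<tau>)"
    using run l powr_real_of_int'[of 2 "int l - 1"] by (auto simp: zero_order_cnm_def)
  show ?thesis
  proof (rule that)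
    show "reached r k l' \<longleftrightarrow> l' \<le> l" for l'
      using l executed_iff_le[of ?oc k l] by (simp add: reached_def)
    show "reached r (Suc k) 0"
      using l executed.advance[of ?oc k l] by (simp add: reached_def)
    show xs: "outer r (Suc k) \<in> edom \<psi>"
      unfolding next_x by (rule zero_order_cubic_steps_edom[OF called[OF l(1)] x]) simp
    show "\<tau>0 \<le> tau r (Suc k)" "tau r (Suc k) \<le> max \<tau>0 L"
      using halt by (simp_all add: next_\<tau>)
    \<comment> \<open>The update makes the next \<open>tau\<close> at least 2^(l-1) times the
      current one, so logarithms charge the retries to the growth of \<open>tau\<close>.\<close>
    have "log 2 (2 powr (real l - 1) * ?\<tau>) \<le> log 2 (tau r (Suc k))"
      unfolding next_\<tau> using \<tau>0 by (subst log_le_cancel_iff) (auto simp: less_max_iff_disj)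
    moreover have "log 2 (2 powr (real l - 1) * ?\<tau>) = real l - 1 + log 2 ?\<tau>"
      using \<tau>0 by (simp add: log_mult)
    ultimately show "real l \<le> 1 + log 2 (tau r (Suc k)) - log 2 ?\<tau>" by linarith
    have "steps (call r k l) = m" and "\<forall>t<m. decrease_test f \<psi> (reg_param ?\<tau> l m) \<epsilon> (outer r k) t (iter (call r k l) (t + 1))"
      using called[OF l(1)] l(2) by (auto simp: zero_order_cubic_steps_def)
    then have "decrease_test f \<psi> (reg_param ?\<tau> l m) \<epsilon> (outer r k) (m - 1) (outer r (Suc k))"
      using pos by (auto simp: next_x dest!: spec[of _ "m - 1"])
    with decrease_test_iff[OF \<psi> x xs] pos
    have "\<epsilon> powr (3/2) / (384 * reg_param ?\<tau> l m powr (1/2)) * real m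
        \<le> real_obj f \<psi> (outer r k) - real_obj f \<psi> (outer r (Suc k))" by simp
    with iteration_decrease_le[OF \<tau>0 pos(2,3) two]
    show "iteration_decrease \<epsilon> m (max \<tau>0 L)
        \<le> real_obj f \<psi> (outer r k) - real_obj f \<psi> (outer r (Suc k))" by linarith
  qed
qed

text \<open>\<open>q k\<close> is the index of the last inner loop of iteration \<open>k\<close>.
  Allowing every finite \<open>K\<close> up to the hitting time lets the decrease estimate also
  prove that the hitting time is finite.\<close>

lemma iterations_before_hitting:
  fixes f :: "real^'n \<Rightarrow> real" and r :: "(real^'n) cnm_run"
  assumes f: "C2 f" "lipschitz_hessian L f" and \<psi>: "proper_closed_convex \<psi>"
    and pos: "0 < \<tau>0" "0 < \<epsilon>" "1 \<le> m" and L: "0 \<le> L" and x0: "x0 \<in> edom \<psi>"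
    and run: "zero_order_cnm f \<psi> x0 \<tau>0 \<epsilon> m r"
    and K: "enat K \<le> hitting_time f \<psi> \<epsilon> r"
  shows "\<exists>q. (\<forall>k<K. \<forall>l. reached r k l \<longleftrightarrow> l \<le> q k)
    \<and> (\<Sum>k<K. real (q k + 1)) \<le> 2 * real K + log 2 (max \<tau>0 L / \<tau>0)
    \<and> outer r K \<in> edom \<psi>
    \<and> real K * iteration_decrease \<epsilon> m (max \<tau>0 L) \<le> real_obj f \<psi> x0 - real_obj f \<psi> (outer r K)"
proof -
  have nonstat: "\<not> eps_stationary f \<psi> \<epsilon> (call r k l) t"
    if "k < K" "reached r k l" "t \<le> steps (call r k l)" for k l t
  proof
    assume "eps_stationary f \<psi> \<epsilon> (call r k l) t"
    with that have "hitting_time f \<psi> \<epsilon> r \<le> enat k"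
      unfolding hitting_time_def by (intro Inf_lower) blast
    with K have "enat K \<le> enat k" by (rule order_trans)
    with \<open>k < K\<close> show False by simp
  qed
  \<comment> \<open>The invariant keeps the logarithm of the current \<open>tau\<close>, so that the
    retry bounds telescope; it is replaced by that of \<open>max \<tau>0 L\<close> only at the
    end.\<close>
  have "\<exists>q. (\<forall>k<J. \<forall>l. reached r k l \<longleftrightarrow> l \<le> q k)
    \<and> reached r J 0 \<and> \<tau>0 \<le> tau r J \<and> tau r J \<le> max \<tau>0 L
    \<and> (\<Sum>k<J. real (q k + 1)) \<le> 2 * real J + log 2 (tau r J) - log 2 \<tau>0
    \<and> outer r J \<in> edom \<psi>
    \<and> real J * iteration_decrease \<epsilon> m (max \<tau>0 L) \<le> real_obj f \<psi> x0 - real_obj f \<psi> (outer r J)"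
    if "J \<le> K" for J
    using that
  proof (induction J)
    case 0
    then show ?case using run x0 executed.start by (simp add: zero_order_cnm_def reached_def)
  next
    case (Suc J)
    then obtain q where q: "\<forall>k<J. \<forall>l. reached r k l \<longleftrightarrow> l \<le> q k"
      and J: "reached r J 0" "outer r J \<in> edom \<psi>" "\<tau>0 \<le> tau r J" "tau r J \<le> max \<tau>0 L"
      and count: "(\<Sum>k<J. real (q k + 1)) \<le> 2 * real J + log 2 (tau r J) - log 2 \<tau>0"
      and dec: "real J * iteration_decrease \<epsilon> m (max \<tau>0 L) \<le> real_obj f \<psi> x0 - real_obj f \<psi> (outer r J)"
      by auto
    have ns: "\<not> eps_stationary f \<psi> \<epsilon> (call r J l) t"
      if "reached r J l" "t \<le> steps (call r J l)" for l t
      using nonstat[of J l t] that Suc.prems by simp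
    obtain l where l: "\<And>l'. reached r J l' \<longleftrightarrow> l' \<le> l" "reached r (Suc J) 0"
      "outer r (Suc J) \<in> edom \<psi>" "\<tau>0 \<le> tau r (Suc J)" "tau r (Suc J) \<le> max \<tau>0 L"
      "real l \<le> 1 + log 2 (tau r (Suc J)) - log 2 (tau r J)"
      "iteration_decrease \<epsilon> m (max \<tau>0 L) \<le> real_obj f \<psi> (outer r J) - real_obj f \<psi> (outer r (Suc J))"
      using iteration_succeeds[OF f \<psi> pos L run ns J] by metis
    have "(\<Sum>k<Suc J. real ((q(J := l)) k + 1)) = (\<Sum>k<J. real (q k + 1)) + real (l + 1)" by simp
    also have "\<dots> \<le> 2 * real (Suc J) + log 2 (tau r (Suc J)) - log 2 \<tau>0" using count l(6) by simp
    finally show ?case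
      using q l dec by (intro exI[of _ "q(J := l)"]) (auto simp: less_Suc_eq algebra_simps)
  qed
  from this[of K] obtain q where q: "\<forall>k<K. \<forall>l. reached r k l \<longleftrightarrow> l \<le> q k"
    and "\<tau>0 \<le> tau r K" "tau r K \<le> max \<tau>0 L"
    and count: "(\<Sum>k<K. real (q k + 1)) \<le> 2 * real K + log 2 (tau r K) - log 2 \<tau>0"
    and rest: "outer r K \<in> edom \<psi>"
      "real K * iteration_decrease \<epsilon> m (max \<tau>0 L) \<le> real_obj f \<psi> x0 - real_obj f \<psi> (outer r K)"
    by auto
  have "log 2 (tau r K) \<le> log 2 (max \<tau>0 L)"
    using \<open>\<tau>0 \<le> tau r K\<close> \<open>tau r K \<le> max \<tau>0 L\<close> pos by simp
  moreover have "log 2 (max \<tau>0 L / \<tau>0) = log 2 (max \<tau>0 L) - log 2 \<tau>0"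
    using pos log_divide_pos[of "max \<tau>0 L" \<tau>0 2] by (auto simp: less_max_iff_disj)
  ultimately show ?thesis using q count rest by (intro exI[of _ q]) auto
qed

section \<open>Counting function evaluations\<close>

lemma size_call_queries:
  fixes r :: "(real^'n) cnm_run"
  shows "size (call_queries \<epsilon> m r k l)
    = 4 * CARD('n)\<^sup>2 + steps (call r k l) * (2 * CARD('n) + 3)"
  by (simp add: call_queries_def Let_def hess_queries_def grad_queries_def power2_eq_square
      algebra_simps)

lemma steps_le:
  fixes r :: "(real^'n) cnm_run"
  assumes "zero_order_cnm f \<psi> x0 \<tau>0 \<epsilon> m r" and "reached r k l"
  shows "steps (call r k l) \<le> m"
proof -
  have "zero_order_cubic_steps f \<psi> (outer r k) (fd_hess f (hess_step CARD('n) (tau r k) l m \<epsilon>) (outer r k))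
      (reg_param (tau r k) l m) m \<epsilon> (call r k l)"
    using assms unfolding zero_order_cnm_def by blast
  then show ?thesis
    unfolding zero_order_cubic_steps_def by (cases "outcome (call r k l)") simp_all
qed

lemma size_call_queries_le:
  fixes r :: "(real^'n) cnm_run"
  assumes "zero_order_cnm f \<psi> x0 \<tau>0 \<epsilon> m r" and "reached r k l"
  shows "real (size (call_queries \<epsilon> m r k l)) \<le> 5 * (real m * real CARD('n) + real CARD('n) ^ 2)"
proof -
  have "steps (call r k l) * (2 * CARD('n) + 3) \<le> m * (2 * CARD('n) + 3)"
    using steps_le[OF assms] by (rule mult_right_mono) simp
  \<comment> \<open>The dimension is at least 1, so 2 n + 3 is at most 5 n.\<close>
  also have "\<dots> \<le> m * (5 * CARD('n))" by (intro mult_left_mono) (auto simp: Suc_leI)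
  finally have "size (call_queries \<epsilon> m r k l) \<le> 5 * (m * CARD('n) + CARD('n)\<^sup>2)"
    unfolding size_call_queries by simp
  then have "real (size (call_queries \<epsilon> m r k l)) \<le> real (5 * (m * CARD('n) + CARD('n)\<^sup>2))"
    by (simp only: of_nat_le_iff)
  then show ?thesis by simp
qed

text \<open>Each iteration before \<open>K\<close> ends with loop \<open>q k\<close>, so the index
  set is finite and the infinite sum becomes an ordinary one.\<close>

lemma zo_count_le:
  fixes r :: "(real^'n) cnm_run"
  assumes run: "zero_order_cnm f \<psi> x0 \<tau>0 \<epsilon> m r"
    and q: "\<forall>k<K. \<forall>l. reached r k l \<longleftrightarrow> l \<le> q k"
  shows "zo_count \<epsilon> m r (enat K)
    \<le> ereal (5 * (real m * real CARD('n) + real CARD('n) ^ 2) * (\<Sum>k<K. real (q k + 1)))"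
proof -
  let ?c = "5 * (real m * real CARD('n) + real CARD('n) ^ 2)"
  let ?S = "Sigma {..<K} (\<lambda>k. {..q k})"
  have S: "{(k, l). reached r k l \<and> enat k < enat K} = ?S" using q by auto
  have "zo_count \<epsilon> m r (enat K) = (\<Sum>(k, l)\<in>?S. ereal (real (size (call_queries \<epsilon> m r k l))))"
    unfolding zo_count_def S by (rule infsum_finite) simp
  also have "\<dots> = ereal (\<Sum>(k, l)\<in>?S. real (size (call_queries \<epsilon> m r k l)))"
    by (simp add: case_prod_unfold)
  also have "\<dots> \<le> ereal (\<Sum>(k, l)\<in>?S. ?c)"
    unfolding ereal_less_eq(3)
    by (intro sum_mono) (use size_call_queries_le[OF run] q in \<open>force\<close>)
  also have "(\<Sum>(k, l)\<in>?S. ?c) = ?c * (\<Sum>k<K. real (q k + 1))"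
    by (simp add: sum.Sigma[symmetric] sum_distrib_left mult.commute)
  finally show ?thesis .
qed

text \<open>3840 is 384 * 10: a factor 5 per call and two calls per iteration up to the logarithmic
  term. The product is at most 6 * 3840 = 23040.\<close>

lemma iteration_bound_numeral: "3840 * 2 powr (5/2) * (2/3) powr (1/6) \<le> (30000::real)"
proof -
  have "2 powr (5/2) = (2::real) powr 2 * 2 powr (1/2)" using powr_add[of "2::real" 2 "1/2"] by simp
  then have "2 powr (5/2) = 4 * sqrt (2::real)" by (simp add: powr_half_sqrt)
  moreover have "sqrt 2 \<le> (3/2::real)" by (rule real_le_lsqrt) (auto simp: power2_eq_square)
  moreover have "(2/3) powr (1/6) \<le> (1::real)" by (rule powr_le1) auto
  ultimately have "2 powr (5/2) * (2/3) powr (1/6) \<le> (6::real) * 1" by (intro mult_mono) auto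
  then show ?thesis by simp
qed

theorem theorem5p5:
  fixes f :: "real^'n \<Rightarrow> real" and \<psi> :: "real^'n \<Rightarrow> ereal"
    and x0 :: "real^'n" and L \<tau>0 \<epsilon> :: real and m :: nat
    and r :: "(real^'n) cnm_run"
  assumes "C2 f" and "proper_closed_convex \<psi>"
    and "inf_obj f \<psi> > -\<infinity>"
    and "L \<ge> 0" and "lipschitz_hessian L f"
    and "x0 \<in> edom \<psi>" and "\<tau>0 > 0" and "\<epsilon> > 0" and "m \<ge> 1"
    and "zero_order_cnm f \<psi> x0 \<tau>0 \<epsilon> m r"
  shows "ereal_of_enat (hitting_time f \<psi> \<epsilon> r)
           \<le> ereal (384 * 2 powr (5/2) * (2/3) powr (1/6) * max \<tau>0 L powr (1/2))
               * (obj f \<psi> x0 - inf_obj f \<psi>) / ereal (sqrt (real m)) * ereal (\<epsilon> powr (-3/2))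
         \<and> zo_count \<epsilon> m r (hitting_time f \<psi> \<epsilon> r)
           \<le> ereal zo_const *
               (ereal ((real m * real CARD('n) + real CARD('n) ^ 2) / sqrt (real m)
                       * max \<tau>0 L powr (1/2))
                  * (obj f \<psi> x0 - inf_obj f \<psi>) * ereal (\<epsilon> powr (-3/2))
                + ereal ((real m * real CARD('n) + 3 * real CARD('n) ^ 2)
                       * log 2 (max \<tau>0 L / \<tau>0)))"
proof -
  note f = \<open>C2 f\<close> \<open>lipschitz_hessian L f\<close> and pos = \<open>0 < \<tau>0\<close> \<open>0 < \<epsilon>\<close> \<open>1 \<le> m\<close>
  note \<psi> = \<open>proper_closed_convex \<psi>\<close> and x0 = \<open>x0 \<in> edom \<psi>\<close>
  note run = \<open>zero_order_cnm f \<psi> x0 \<tau>0 \<epsilon> m r\<close>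
  note before = iterations_before_hitting[OF f \<psi> pos \<open>0 \<le> L\<close> x0 run]
  let ?N = "max \<tau>0 L"
  let ?\<Delta> = "iteration_decrease \<epsilon> m ?N"
  let ?n = "real CARD('n)"
  have inf_le: "inf_obj f \<psi> \<le> obj f \<psi> x" if "x \<in> edom \<psi>" for x
    unfolding inf_obj_def using that by (rule INF_lower)
  obtain F where F: "inf_obj f \<psi> = ereal F"
    using inf_le[OF x0] obj_eq_real_obj[OF \<psi> x0, of f] \<open>- \<infinity> < inf_obj f \<psi>\<close>
    by (cases "inf_obj f \<psi>") auto
  define D where "D = real_obj f \<psi> x0 - F"
  have D: "obj f \<psi> x0 - inf_obj f \<psi> = ereal D"
    by (simp add: F D_def obj_eq_real_obj[OF \<psi> x0])
  have F_le: "F \<le> real_obj f \<psi> x" if "x \<in> edom \<psi>" for x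
    using inf_le[OF that] by (simp add: F obj_eq_real_obj[OF \<psi> that])
  have \<Delta>: "0 < ?\<Delta>" using pos by (auto simp: iteration_decrease_def less_max_iff_disj)
  have total: "real K * ?\<Delta> \<le> D" if "enat K \<le> hitting_time f \<psi> \<epsilon> r" for K
    using before[OF that] F_le unfolding D_def by fastforce
  \<comment> \<open>An infinite hitting time would make \<open>total\<close> hold for every
    \<open>K\<close>, against the Archimedean property.\<close>
  obtain T where T: "hitting_time f \<psi> \<epsilon> r = enat T"
  proof (cases "hitting_time f \<psi> \<epsilon> r")
    case infinity
    obtain K where "D < real K * ?\<Delta>" using reals_Archimedean3[OF \<Delta>] by blast
    with total[of K] infinity show ?thesis by simp
  qed
  obtain q where q: "\<forall>k<T. \<forall>l. reached r k l \<longleftrightarrow> l \<le> q k"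
    and count: "(\<Sum>k<T. real (q k + 1)) \<le> 2 * real T + log 2 (?N / \<tau>0)"
    using before[of T] T by auto
  \<comment> \<open>The factor common to both bounds, free of the dimension and of numerical
    constants.\<close>
  define R where "R = ?N powr (1/2) * D / sqrt (real m) * \<epsilon> powr (-3/2)"
  have inv: "D / ?\<Delta> = 384 * 2 powr (5/2) * (2/3) powr (1/6) * R"
    using pos by (simp add: iteration_decrease_def R_def powr_minus field_simps)
  have TR: "real T \<le> 384 * 2 powr (5/2) * (2/3) powr (1/6) * R"
    using total[of T] \<Delta> unfolding inv[symmetric] by (simp add: T pos_le_divide_eq)
  have D0: "0 \<le> D" using F_le[OF x0] by (simp add: D_def)
  then have R0: "0 \<le> R" by (simp add: R_def)
  have log0: "0 \<le> log 2 (?N / \<tau>0)" using pos by simp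
  let ?c = "real m * ?n + ?n ^ 2"
  have "5 * ?c * (\<Sum>k<T. real (q k + 1)) \<le> 5 * ?c * (2 * real T + log 2 (?N / \<tau>0))"
    using count by (intro mult_left_mono) auto
  also have "\<dots> = ?c * (10 * real T) + 5 * ?c * log 2 (?N / \<tau>0)" by (simp add: algebra_simps)
  also have "\<dots> \<le> ?c * (zo_const * R) + zo_const * (real m * ?n + 3 * ?n ^ 2) * log 2 (?N / \<tau>0)"
  proof (intro add_mono mult_left_mono mult_right_mono log0)
    have "10 * real T \<le> 3840 * 2 powr (5/2) * (2/3) powr (1/6) * R" using TR by linarith
    also have "\<dots> \<le> zo_const * R"
      unfolding zo_const_def by (intro mult_right_mono iteration_bound_numeral R0)
    finally show "10 * real T \<le> zo_const * R" .
    show "5 * ?c \<le> zo_const * (real m * ?n + 3 * ?n ^ 2)"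
      unfolding zo_const_def by (intro mult_mono) auto
  qed simp
  finally have "zo_count \<epsilon> m r (enat T)
      \<le> ereal (?c * (zo_const * R) + zo_const * (real m * ?n + 3 * ?n ^ 2) * log 2 (?N / \<tau>0))"
    using zo_count_le[OF run q] by (meson ereal_less_eq(3) order_trans)
  \<comment> \<open>The objective gap is finite, so the extended-real expressions reduce to real
    ones.\<close>
  moreover have E1: "ereal (384 * 2 powr (5/2) * (2/3) powr (1/6) * ?N powr (1/2)) * ereal D
      / ereal (sqrt (real m)) * ereal (\<epsilon> powr (-3/2))
      = ereal (384 * 2 powr (5/2) * (2/3) powr (1/6) * R)"
    using pos by (simp add: R_def)
  moreover have E2: "ereal zo_const * (ereal (?c / sqrt (real m) * ?N powr (1/2)) * ereal D
      * ereal (\<epsilon> powr (-3/2)) + ereal ((real m * ?n + 3 * ?n ^ 2) * log 2 (?N / \<tau>0)))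
      = ereal (?c * (zo_const * R) + zo_const * (real m * ?n + 3 * ?n ^ 2) * log 2 (?N / \<tau>0))"
    by (simp add: R_def algebra_simps)
  ultimately show ?thesis
    using TR unfolding D T E1 E2 ereal_of_enat_simps ereal_less_eq(3) by blast
qed

end
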